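(* Let $W=[0,1]^d$, let $\mathfrak{m}$ be a stationary random tessellation of $\mathbf{R}^d$ of intensity $1$, with typical cell $\mathcal{C}$, and let $f:\mathcal{K}_d\to\mathbf{R}$ be translation invariant and measurable, such that Condition 1 (stated in the context) holds. Assume that for every $\tau\ge0$ there exists a deterministic function $v_\rho(\tau)$ of $\rho$ such that $\rho\cdot\mathbb{P}(f(\mathcal{C})>v_\rho(\tau))\to\tau$ as $\rho\to\infty$. Then there exist constants $\theta,\theta'$ with $0\le\theta\le\theta'\le1$ such that, for all $\tau\ge0$, $$\limsup_{\rho\to\infty}\mathbb{P}(M_{f,\mathbf{W}_\rho}\le v_\rho(\tau))=e^{-\theta\tau}\quad\text{and}\quad\liminf_{\rho\to\infty}\mathbb{P}(M_{f,\mathbf{W}_\rho}\le v_\rho(\tau))=e^{-\theta'\tau}.$$ In particular, if $\mathbb{P}(M_{f,\mathbf{W}_\rho}\le v_\rho(\tau))$ converges, then $\theta=\theta'$ and $\mathbb{P}(M_{f,\mathbf{W}_\rho}\le v_\rho(\tau))\to e^{-\theta\tau}$ as $\rho\to\infty$.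
   Context: A tessellation of $\mathbf{R}^d$ is a countable collection of compact sets (cells; here convex bodies) with disjoint interiors which covers $\mathbf{R}^d$ and such that only finitely many cells meet any bounded set. A random tessellation $\mathfrak{m}$ is a random variable with values in the set of tessellations (with the $\sigma$-algebra induced by the Fell topology); it is stationary if its law is invariant under translations. To each cell $C$ is associated deterministically a point $z(C)$, its nucleus, with $z(C+x)=z(C)+x$ for all $x\in\mathbf{R}^d$. $\lambda_d$ is Lebesgue measure and $\mathcal{K}_d$ is the set of convex bodies of $\mathbf{R}^d$ with the Hausdorff topology. For a Borel set $B$ with $\lambda_d(B)\in(0,\infty)$, the intensity is $\gamma=\lambda_d(B)^{-1}\mathbb{E}[\#\{C\in\mathfrak{m}: z(C)\in B\}]$ (independent of $B$), and here $\gamma=1$; the typical cell $\mathcal{C}$ is the random polytope with law given by $\mathbb{E}[g(\mathcal{C})]=\lambda_d(B)^{-1}\mathbb{E}\big[\sum_{C\in\mathfrak{m}, z(C)\in B}g(C-z(C))\big]$ for bounded measurable $g:\mathcal{K}_d\to\mathbf{R}$. $f$ translation invariant means $f(C+x)=f(C)$ for all $C,x$. $\mathbf{W}_\rho=\rho^{1/d}W$ and $M_{f,\mathbf{W}_\rho}=\max\{f(C):C\in\mathfrak{m},z(C)\in\mathbf{W}_\rho\}$. Let $\mathbf{C}^{(W)}$ be a cube containing $W$. The cube $\mathbf{C}^{(W)}_\rho=\rho^{1/d}\mathbf{C}^{(W)}$ is partitioned into a set $V_\rho$ of $N_\rho$ sub-cubes of equal size, with $N_\rho\to\infty$ as $\rho\to\infty$.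 Sub-cubes are identified with indices $\mathbf{i}=(i_1,\dots,i_d)$; $d(\mathbf{i},\mathbf{j})=\max_{1\le r\le d}|i_r-j_r|$ and, for sets $A,B$ of sub-cubes, $d(A,B)=\min_{\mathbf{i}\in A,\mathbf{j}\in B}d(\mathbf{i},\mathbf{j})$. $M_{f,\mathbf{i}}=\max\{f(C): C\in\mathfrak{m}, z(C)\in\mathbf{i}\cap\mathbf{W}_\rho\}$, with value $-\infty$ if there is no such cell. Condition 1: there exist an integer $R$ and an event $A_\rho$ with $\mathbb{P}(A_\rho)\to 1$ as $\rho\to\infty$ such that, conditional on $A_\rho$, the $\sigma$-algebras $\sigma\{M_{f,\mathbf{i}},\mathbf{i}\in A\}$ and $\sigma\{M_{f,\mathbf{i}},\mathbf{i}\in B\}$ are independent whenever $d(A,B)>R$. *)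

theory Defs
  imports "HOL-Probability.Probability"
begin

section \<open>Convex bodies with the Hausdorff metric\<close>

definition convex_bodies :: "'a::euclidean_space set set" where
  "convex_bodies = {C. C \<noteq> {} \<and> compact C \<and> convex C}"

text \<open>The value 0 outside of \<^const>\<open>convex_bodies\<close> is needed only because the locale
  \<^locale>\<open>Metric_space\<close> asks for nonnegativity on the whole type.\<close>

definition hausdist :: "'a::euclidean_space set \<Rightarrow> 'a set \<Rightarrow> real" where
  "hausdist C D =
    (if C \<in> convex_bodies \<and> D \<in> convex_bodies
     then max (SUP x\<in>C. infdist x D) (SUP y\<in>D. infdist y C) else 0)"

lemma hausdist_le_iff:
  assumes "C \<in> convex_bodies" "D \<in> convex_bodies"
  shows "hausdist C D \<le> r \<longleftrightarrow> (\<forall>x\<in>C. infdist x D \<le> r) \<and> (\<forall>y\<in>D. infdist y C \<le> r)"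
proof -
  have bdd: "bdd_above ((\<lambda>x. infdist x D) ` C)" if "C \<in> convex_bodies" for C D :: "'a set"
  proof -
    have "compact ((\<lambda>x. infdist x D) ` C)"
      using that by (intro compact_continuous_image continuous_intros)
        (auto simp: convex_bodies_def)
    then show ?thesis
      by (simp add: bounded_imp_bdd_above compact_imp_bounded)
  qed
  have ne: "C \<noteq> {}" "D \<noteq> {}"
    using assms by (auto simp: convex_bodies_def)
  show ?thesis
    using assms
    by (simp add: hausdist_def cSUP_le_iff[OF ne(1) bdd[OF assms(1)]]
        cSUP_le_iff[OF ne(2) bdd[OF assms(2)]])
qed

lemma infdist_le_hausdist:
  assumes "C \<in> convex_bodies" "D \<in> convex_bodies" "x \<in> C"
  shows "infdist x D \<le> hausdist C D"
  using hausdist_le_iff[OF assms(1,2), of "hausdist C D"] assms(3) by auto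

lemma hausdist_commute: "hausdist C D = hausdist D C"
  by (auto simp: hausdist_def max.commute)

lemma hausdist_nonneg: "0 \<le> hausdist C D"
proof (cases "C \<in> convex_bodies \<and> D \<in> convex_bodies")
  case True
  then obtain x where "x \<in> C" by (auto simp: convex_bodies_def)
  with True show ?thesis
    using infdist_le_hausdist[of C D x] infdist_nonneg[of x D] by linarith
qed (auto simp: hausdist_def)

lemma infdist_triangle_hausdist:
  assumes "D \<in> convex_bodies" "E \<in> convex_bodies"
  shows "infdist x E \<le> infdist x D + hausdist D E"
proof -
  from assms(1) have "closed D" "D \<noteq> {}"
    by (auto simp: convex_bodies_def compact_imp_closed)
  then obtain y where y: "y \<in> D" "infdist x D = dist x y"
    by (rule infdist_attains_inf)
  show ?thesis
    using infdist_triangle[of x E y] infdist_le_hausdist[OF assms y(1)] y(2) by linarith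
qed

interpretation hausdist: Metric_space convex_bodies hausdist
proof
  fix C D :: "'a set"
  assume CD: "C \<in> convex_bodies" "D \<in> convex_bodies"
  have closed: "closed C" "C \<noteq> {}" "closed D" "D \<noteq> {}"
    using CD by (auto simp: convex_bodies_def compact_imp_closed)
  have "hausdist C D = 0 \<longleftrightarrow> hausdist C D \<le> 0"
    using hausdist_nonneg[of C D] by linarith
  also have "\<dots> \<longleftrightarrow> (\<forall>x\<in>C. infdist x D = 0) \<and> (\<forall>y\<in>D. infdist y C = 0)"
    by (simp add: hausdist_le_iff[OF CD] order.antisym_conv2 infdist_nonneg order.eq_iff)
  also have "\<dots> \<longleftrightarrow> C = D"
    using closed by (auto simp flip: in_closed_iff_infdist_zero)
  finally show "hausdist C D = 0 \<longleftrightarrow> C = D" .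
next
  fix C D E :: "'a set"
  assume CDE: "C \<in> convex_bodies" "D \<in> convex_bodies" "E \<in> convex_bodies"
  show "hausdist C E \<le> hausdist C D + hausdist D E"
    unfolding hausdist_le_iff[OF CDE(1,3)]
  proof (intro conjI ballI)
    fix x assume "x \<in> C"
    then show "infdist x E \<le> hausdist C D + hausdist D E"
      using infdist_triangle_hausdist[OF CDE(2,3), of x] infdist_le_hausdist[OF CDE(1,2), of x]
      by linarith
  next
    fix x assume "x \<in> E"
    then show "infdist x C \<le> hausdist C D + hausdist D E"
      using infdist_triangle_hausdist[OF CDE(2,1), of x] infdist_le_hausdist[OF CDE(3,2), of x]
      by (simp add: hausdist_commute)
  qed
qed (simp_all add: hausdist_nonneg hausdist_commute)

definition borel_of_topology :: "'a topology \<Rightarrow> 'a measure" where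
  "borel_of_topology T = sigma (topspace T) {U. openin T U}"

definition convex_body_borel :: "'a::euclidean_space set measure" where
  "convex_body_borel = borel_of_topology hausdist.mtopology"


section \<open>Random tessellations\<close>

definition tessellations :: "'a::euclidean_space set set set" where
  "tessellations =
    {m. countable m \<and> m \<subseteq> convex_bodies \<and>
        pairwise (\<lambda>C D. interior C \<inter> interior D = {}) m \<and>
        \<Union>m = UNIV \<and>
        (\<forall>B. bounded B \<longrightarrow> finite {C \<in> m. C \<inter> B \<noteq> {}})}"

definition fell_topology :: "'a topology \<Rightarrow> 'a set topology" where
  "fell_topology T = topology_generated_by
    ({{F. closedin T F \<and> F \<inter> G \<noteq> {}} | G. openin T G} \<union>
     {{F. closedin T F \<and> F \<inter> K = {}} | K. compactin T K})"

text \<open>By local finiteness a tessellation is a closed set in the space of convex bodies.\<close>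

lemma tessellation_closedin:
  assumes "m \<in> tessellations"
  shows "closedin hausdist.mtopology m"
proof -
  have "\<exists>r>0. disjnt m (hausdist.mball C r)" if C: "C \<in> convex_bodies - m" for C
  proof -
    have "bounded C"
      using C by (auto simp: convex_bodies_def compact_imp_bounded)
    then obtain x e where e: "C \<subseteq> cball x e"
      unfolding bounded_subset_cball by blast
    define N where "N = {D \<in> m. D \<inter> cball x (e + 1) \<noteq> {}}"
    have N: "finite N" "N \<subseteq> convex_bodies" "C \<notin> N"
      using assms C by (auto simp: tessellations_def N_def)
    have near: "D \<in> N" if D: "D \<in> m" "hausdist C D < 1" for D
    proof -
      have DK: "D \<in> convex_bodies" using assms D by (auto simp: tessellations_def)
      obtain c where c: "c \<in> C" using C by (auto simp: convex_bodies_def)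
      have "closed D" "D \<noteq> {}"
        using DK by (auto simp: convex_bodies_def compact_imp_closed)
      then obtain y where y: "y \<in> D" "infdist c D = dist c y"
        by (rule infdist_attains_inf)
      have "dist c y < 1"
        using infdist_le_hausdist[of C D c] C DK c D y by auto
      moreover have "dist x c \<le> e" using c e by auto
      ultimately have "dist x y \<le> e + 1"
        using dist_triangle[of x y c] by linarith
      then show ?thesis using y D by (auto simp: N_def)
    qed
    define r where "r = Min (insert 1 (hausdist C ` N))"
    have "0 < hausdist C D" if "D \<in> N" for D
      using that N C hausdist.mdist_pos_eq[of C D] by auto
    then have "0 < r" using N by (simp add: r_def)
    moreover have "disjnt m (hausdist.mball C r)"
      unfolding disjnt_iff
    proof (intro allI notI, elim conjE)
      fix D assume D: "D \<in> m" "D \<in> hausdist.mball C r"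
      then have "hausdist C D < r" by simp
      moreover have "r \<le> 1" using N(1) by (simp add: r_def)
      ultimately have "D \<in> N" using near[of D] D by linarith
      then have "r \<le> hausdist C D" using N(1) by (simp add: r_def Min_le)
      with \<open>hausdist C D < r\<close> show False by linarith
    qed
    ultimately show ?thesis by blast
  qed
  moreover have "m \<subseteq> convex_bodies" using assms by (auto simp: tessellations_def)
  ultimately show ?thesis by (auto simp: hausdist.closedin_metric)
qed

definition tessellation_algebra :: "'a::euclidean_space set set measure" where
  "tessellation_algebra =
    restrict_space (borel_of_topology (fell_topology hausdist.mtopology)) tessellations"

lemma topspace_fell_topology: "topspace (fell_topology T) = {F. closedin T F}"
proof -
  have "{F. closedin T F} = {F. closedin T F \<and> F \<inter> {} = {}} \<and> compactin T {}"
    by auto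
  then have "{F. closedin T F} \<in> {{F. closedin T F \<and> F \<inter> K = {}} | K. compactin T K}"
    by blast
  then show ?thesis
    unfolding fell_topology_def topology_generated_by_topspace by blast
qed

lemma space_tessellation_algebra: "space tessellation_algebra = tessellations"
  by (auto simp: tessellation_algebra_def space_restrict_space borel_of_topology_def
      topspace_fell_topology space_measure_of_conv tessellation_closedin)

definition translate :: "'a::euclidean_space \<Rightarrow> 'a set \<Rightarrow> 'a set" where
  "translate x C = (+) x ` C"

definition random_tessellation ::
    "'w measure \<Rightarrow> ('w \<Rightarrow> 'a::euclidean_space set set) \<Rightarrow> bool" where
  "random_tessellation M \<mm> \<longleftrightarrow> prob_space M \<and> \<mm> \<in> measurable M tessellation_algebra"

definition stationary :: "'w measure \<Rightarrow> ('w \<Rightarrow> 'a::euclidean_space set set) \<Rightarrow> bool" where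
  "stationary M \<mm> \<longleftrightarrow>
    (\<forall>x. distr M tessellation_algebra (\<lambda>\<omega>. translate x ` \<mm> \<omega>) =
         distr M tessellation_algebra \<mm>)"

definition nucleus_map :: "('a::euclidean_space set \<Rightarrow> 'a) \<Rightarrow> bool" where
  "nucleus_map z \<longleftrightarrow>
    z \<in> measurable convex_body_borel borel \<and>
    (\<forall>C\<in>convex_bodies. \<forall>x. z (translate x C) = z C + x)"

definition translation_invariant :: "('a::euclidean_space set \<Rightarrow> real) \<Rightarrow> bool" where
  "translation_invariant f \<longleftrightarrow> (\<forall>C\<in>convex_bodies. \<forall>x. f (translate x C) = f C)"

definition cells_in ::
    "('a::euclidean_space set \<Rightarrow> 'a) \<Rightarrow> 'a set set \<Rightarrow> 'a set \<Rightarrow> 'a set set" where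
  "cells_in z m B = {C \<in> m. z C \<in> B}"

text \<open>The intensity is a number that serves every window; the counting measure is used because
  infinitely many nuclei in a window are not excluded surely.\<close>

definition has_intensity ::
    "'w measure \<Rightarrow> ('w \<Rightarrow> 'a::euclidean_space set set) \<Rightarrow> ('a set \<Rightarrow> 'a) \<Rightarrow> real \<Rightarrow> bool" where
  "has_intensity M \<mm> z \<gamma> \<longleftrightarrow>
    (\<forall>B\<in>sets borel. 0 < emeasure lborel B \<and> emeasure lborel B < \<infinity> \<longrightarrow>
      (\<integral>\<^sup>+\<omega>. emeasure (count_space UNIV) (cells_in z (\<mm> \<omega>) B) \<partial>M) / emeasure lborel B
        = ennreal \<gamma>)"

text \<open>The random convex body \<open>X\<close>, possibly on another probability space \<open>N\<close>, has the law of
  the typical cell.\<close>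

definition typical_cell ::
    "'w measure \<Rightarrow> ('w \<Rightarrow> 'a::euclidean_space set set) \<Rightarrow> ('a set \<Rightarrow> 'a) \<Rightarrow>
     'v measure \<Rightarrow> ('v \<Rightarrow> 'a set) \<Rightarrow> bool" where
  "typical_cell M \<mm> z N X \<longleftrightarrow>
    prob_space N \<and> X \<in> measurable N convex_body_borel \<and>
    (\<forall>g\<in>borel_measurable convex_body_borel. \<forall>B\<in>sets borel.
      bounded (g ` convex_bodies) \<and> 0 < emeasure lborel B \<and> emeasure lborel B < \<infinity> \<longrightarrow>
      (\<integral>\<omega>. g (X \<omega>) \<partial>N) =
      (\<integral>\<omega>. (\<Sum>\<^sub>\<infinity>C\<in>cells_in z (\<mm> \<omega>) B. g (translate (- z C) C)) \<partial>M) / measure lborel B)"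


section \<open>Maxima over windows and the mixing condition\<close>

text \<open>A maximum over finitely many cells; the supremum of the empty set is \<open>-\<infinity>\<close>.\<close>

definition cell_max ::
    "('a::euclidean_space set \<Rightarrow> real) \<Rightarrow> ('a set \<Rightarrow> 'a) \<Rightarrow> 'a set set \<Rightarrow> 'a set \<Rightarrow> ereal" where
  "cell_max f z m B = (SUP C\<in>cells_in z m B. ereal (f C))"

definition dilate :: "real \<Rightarrow> (real ^ 'n) set \<Rightarrow> (real ^ 'n) set" where
  "dilate \<rho> S = (\<lambda>x. (\<rho> powr (1 / real CARD('n))) *\<^sub>R x) ` S"

text \<open>The cube with lower corner \<open>a\<close> and side length \<open>s\<close> is divided into \<open>n ^ CARD('n)\<close>
  sub-cubes. They are half-open, except that the last one in each direction also contains
  the upper face of the cube, so that they form a genuine partition.\<close>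

definition cube :: "real ^ 'n \<Rightarrow> real \<Rightarrow> (real ^ 'n) set" where
  "cube a s = cbox a (a + vec s)"

definition grid :: "nat \<Rightarrow> ('n::finite \<Rightarrow> nat) set" where
  "grid n = {i. \<forall>r. i r < n}"

definition subcube :: "real ^ 'n \<Rightarrow> real \<Rightarrow> nat \<Rightarrow> ('n \<Rightarrow> nat) \<Rightarrow> (real ^ 'n) set" where
  "subcube a s n i =
    {x. \<forall>r. a $ r + s * real (i r) / real n \<le> x $ r \<and>
            (x $ r < a $ r + s * real (i r + 1) / real n \<or>
             i r + 1 = n \<and> x $ r = a $ r + s)}"

lemma subcubes_partition:
  fixes a :: "real ^ 'n"
  assumes "0 < s" "0 < n"
  shows "(\<Union>i\<in>grid n. subcube a s n i) = cube a s"
    and "disjoint_family_on (subcube a s n) (grid n)"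
proof -
  show "(\<Union>i\<in>grid n. subcube a s n i) = cube a s"
  proof (intro equalityI subsetI)
    fix x assume "x \<in> (\<Union>i\<in>grid n. subcube a s n i)"
    then obtain i where i: "\<And>r. i r < n" "x \<in> subcube a s n i"
      by (auto simp: grid_def)
    have "a $ r \<le> x $ r \<and> x $ r \<le> a $ r + s" for r
    proof -
      have "0 \<le> s * real (i r) / real n" using assms by simp
      moreover have "s * real (i r + 1) / real n \<le> s"
      proof -
        have "real (i r + 1) \<le> real n" using i(1)[of r] by linarith
        then show ?thesis using assms by (simp add: pos_divide_le_eq mult_left_mono)
      qed
      moreover have "a $ r + s * real (i r) / real n \<le> x $ r"
        "x $ r < a $ r + s * real (i r + 1) / real n \<or> x $ r = a $ r + s"
        using i(2) by (auto simp: subcube_def)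
      ultimately show ?thesis by linarith
    qed
    then show "x \<in> cube a s"
      by (simp add: cube_def mem_box_cart)
  next
    fix x assume "x \<in> cube a s"
    then have x: "a $ r \<le> x $ r" "x $ r \<le> a $ r + s" for r
      by (simp_all add: cube_def mem_box_cart)
    define t where "t r = (x $ r - a $ r) * real n / s" for r
    have t: "0 \<le> t r" "x $ r = a $ r + s * t r / real n" for r
      using x(1)[of r] assms by (simp_all add: t_def)
    define i where "i r = min (n - 1) (nat \<lfloor>t r\<rfloor>)" for r
    have tn: "t r \<le> real n" for r
    proof -
      have "(x $ r - a $ r) * real n \<le> s * real n"
        using x(2)[of r] by (intro mult_right_mono) auto
      then show ?thesis using assms by (simp add: t_def pos_divide_le_eq mult.commute)
    qed
    have "real (i r) \<le> t r \<and> (t r < real (i r + 1) \<or> i r + 1 = n \<and> t r = real n)" for r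
    proof (cases "nat \<lfloor>t r\<rfloor> \<le> n - 1")
      case True
      then have "i r = nat \<lfloor>t r\<rfloor>" by (simp add: i_def)
      then show ?thesis using t(1)[of r] by (simp; linarith)
    next
      case False
      then have "int n \<le> \<lfloor>t r\<rfloor>" using assms(2) by linarith
      then have "real n \<le> t r" by (simp add: le_floor_iff)
      then show ?thesis using False tn[of r] assms(2) by (auto simp: i_def)
    qed note * = this
    have "x \<in> subcube a s n i"
      unfolding subcube_def
    proof (safe, goal_cases)
      case (1 r)
      then show ?case using *[of r] assms
        by (subst t(2)) (simp add: divide_right_mono mult_left_mono)
    next
      case (2 r)
      then show ?case using *[of r] assms t(2)[of r]
        by (auto simp: divide_strict_right_mono mult_strict_left_mono)
    next
      case (3 r)
      then show ?case using *[of r] assms t(2)[of r]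
        by (auto simp: divide_strict_right_mono mult_strict_left_mono)
    qed
    moreover have "i \<in> grid n" using assms(2) by (auto simp: grid_def i_def min_less_iff_disj)
    ultimately show "x \<in> (\<Union>i\<in>grid n. subcube a s n i)" by blast
  qed
  have le: "i r \<le> j r"
    if "i \<in> grid n" "j \<in> grid n" "x \<in> subcube a s n i" "x \<in> subcube a s n j" for i j x r
  proof (rule ccontr)
    assume "\<not> i r \<le> j r"
    then have ji: "j r + 1 \<le> i r" by simp
    have "i r < n" using that(1) by (simp add: grid_def)
    with ji have jn: "j r + 1 \<noteq> n" by linarith
    have "s * real (j r + 1) / real n \<le> s * real (i r) / real n"
      using ji assms by (intro divide_right_mono mult_left_mono) linarith+
    moreover have "a $ r + s * real (i r) / real n \<le> x $ r"
      "x $ r < a $ r + s * real (j r + 1) / real n"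
      using that jn by (auto simp: subcube_def)
    ultimately show False by linarith
  qed
  show "disjoint_family_on (subcube a s n) (grid n)"
    unfolding disjoint_family_on_def
  proof (intro ballI impI equals0I)
    fix i j x
    assume ij: "i \<in> grid n" "j \<in> grid n" "i \<noteq> j" and "x \<in> subcube a s n i \<inter> subcube a s n j"
    then have "i r = j r" for r
      using le[of i j x r] le[of j i x r] by simp
    then have "i = j" by (rule ext)
    with ij show False by simp
  qed
qed

lemma card_grid: "card (grid n :: ('n::finite \<Rightarrow> nat) set) = n ^ CARD('n)"
proof -
  have "(grid n :: ('n \<Rightarrow> nat) set) = PiE UNIV (\<lambda>_. {..<n})"
    by (auto simp: grid_def PiE_def)
  then show ?thesis by (simp add: card_PiE)
qed

definition index_dist :: "('n::finite \<Rightarrow> nat) \<Rightarrow> ('n \<Rightarrow> nat) \<Rightarrow> int" where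
  "index_dist i j = Max (range (\<lambda>r. \<bar>int (i r) - int (j r)\<bar>))"

definition index_set_dist :: "('n::finite \<Rightarrow> nat) set \<Rightarrow> ('n \<Rightarrow> nat) set \<Rightarrow> int" where
  "index_set_dist I J = Min {index_dist i j | i j. i \<in> I \<and> j \<in> J}"

definition subcube_max ::
    "(real ^ 'n) set \<Rightarrow> real ^ 'n \<Rightarrow> real \<Rightarrow> nat \<Rightarrow> ((real ^ 'n) set \<Rightarrow> real) \<Rightarrow>
     ((real ^ 'n) set \<Rightarrow> real ^ 'n) \<Rightarrow> (real ^ 'n) set set \<Rightarrow> real \<Rightarrow> ('n \<Rightarrow> nat) \<Rightarrow> ereal" where
  "subcube_max W a s n f z m \<rho> i = cell_max f z m (dilate \<rho> (subcube a s n i) \<inter> dilate \<rho> W)"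

definition generated_events ::
    "'w measure \<Rightarrow> ('i \<Rightarrow> 'w \<Rightarrow> ereal) \<Rightarrow> 'i set \<Rightarrow> 'w set set" where
  "generated_events M Y I =
    sigma_sets (space M) {Y i -` S \<inter> space M | i S. i \<in> I \<and> S \<in> sets borel}"

text \<open>\<open>n \<rho>\<close> is the number of sub-cubes along each edge, \<^term>\<open>uniform_measure M (A \<rho>)\<close> is the
  conditional probability given the event \<open>A \<rho>\<close>.\<close>

definition mixing_condition ::
    "'w measure \<Rightarrow> ('w \<Rightarrow> (real ^ 'n) set set) \<Rightarrow> ((real ^ 'n) set \<Rightarrow> real ^ 'n) \<Rightarrow>
     ((real ^ 'n) set \<Rightarrow> real) \<Rightarrow> (real ^ 'n) set \<Rightarrow> real ^ 'n \<Rightarrow> real \<Rightarrow> (real \<Rightarrow> nat) \<Rightarrow> bool" where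
  "mixing_condition M \<mm> z f W a s n \<longleftrightarrow>
    (\<exists>(R::int) (A :: real \<Rightarrow> 'w set).
      (\<forall>\<rho>>0. A \<rho> \<in> sets M) \<and>
      ((\<lambda>\<rho>. measure M (A \<rho>)) \<longlongrightarrow> 1) at_top \<and>
      (\<forall>\<rho>>0. \<forall>I J. I \<subseteq> grid (n \<rho>) \<and> J \<subseteq> grid (n \<rho>) \<and> I \<noteq> {} \<and> J \<noteq> {} \<and>
          index_set_dist I J > R \<longrightarrow>
        prob_space.indep_set (uniform_measure M (A \<rho>))
          (generated_events M (\<lambda>i \<omega>. subcube_max W a s (n \<rho>) f z (\<mm> \<omega>) \<rho> i) I)
          (generated_events M (\<lambda>i \<omega>. subcube_max W a s (n \<rho>) f z (\<mm> \<omega>) \<rho> i) J)))"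

end

theory Submission
  imports Defs
begin

text \<open>
  Cut the window \<open>W\<^sub>\<rho>\<close> into \<open>K = m\<^sup>d\<close> congruent blocks and shrink each block slightly. For large \<open>\<rho>\<close> the
  sub-cubes meeting distinct shrunken blocks have index distance greater than \<open>R\<close>, so Condition 1
  makes the maxima over these unions of sub-cubes independent up to \<open>1 - P(A\<^sub>\<rho>)\<close>. The gap between the blocks
  contains exceedances with probability at most its volume times \<open>P(f(C) > v\<^sub>\<rho>(\<tau>))\<close>, which is a small
  multiple of \<open>\<tau>\<close>. By stationarity each block contributes the same factor, so
  \<open>F(\<rho>, \<tau>) = P(M \<le> v\<^sub>\<rho>(\<tau>))\<close> satisfies \<open>F(\<rho>, \<tau>) - F(\<rho>/K, \<tau>/K)\<^sup>K \<rightarrow> 0\<close>. Hence both the upper and the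
  lower limit \<open>\<psi>\<close> satisfy \<open>\<psi>(\<tau>) = \<psi>(\<tau>/K)\<^sup>K\<close>, and together with \<open>\<psi>(\<tau>) \<ge> 1 - \<tau>\<close> and
  \<open>\<bar>\<psi>(\<tau>) - \<psi>(\<tau>')\<bar> \<le> \<bar>\<tau> - \<tau>'\<bar>\<close> this forces \<open>\<psi>(\<tau>) = exp (-\<theta>\<tau>)\<close>.
\<close>

section \<open>Measurability of cell counts\<close>

text \<open>Neighbouring full blocks touch, and Condition 1 says nothing about sub-cubes at index
  distance at most \<open>R\<close>; hence the shrinking. The margin \<open>\<epsilon>\<close> is a
  fixed fraction of the window, chosen from the target error before \<open>\<rho>\<close> grows,
  while the sub-cubes become small relative to the window, so every fixed \<open>R\<close> is
  eventually exceeded.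

  The thresholds for \<open>(\<rho>, \<tau>)\<close> and \<open>(\<rho>/K, \<tau>/K)\<close> have no
  direct relation. They are compared through tails: two laws of the maximum over one window differ
  by at most the volume times the difference of the tails, and \<open>\<rho>/K\<close> times either
  tail tends to \<open>\<tau>/K\<close>. The same estimate gives the Lipschitz bound.

  Upper and lower limits do not respect sums or products, but they commute with continuous
  increasing maps such as the \<open>K\<close>-th power on \<open>[0, 1]\<close>; so both satisfy
  the same equation. As \<open>K\<close> runs only through \<open>d\<close>-th powers, that equation
  fixes \<open>ln \<psi>\<close> on \<open>d\<close>-th powers of rationals, and continuity fills in
  the rest. The bound \<open>\<psi>(\<tau>) \<ge> 1 - \<tau>\<close> keeps \<open>\<psi>\<close>
  away from zero, so that the logarithm exists, and yields \<open>\<theta> \<le> 1\<close>.\<close>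

lemma hull_finite_mem_convex_bodies:
  fixes T :: "'a::euclidean_space set"
  assumes "finite T" "T \<noteq> {}"
  shows "convex hull T \<in> convex_bodies"
  using assms by (simp add: convex_bodies_def finite_imp_compact_convex_hull)

text \<open>The closed \<open>r\<close>-neighbourhood of a closed set is its Minkowski sum with a
  closed ball, and sums of convex sets are convex. It is used to keep the hull of finitely many
  points near \<open>C\<close> near \<open>C\<close>.\<close>

lemma convex_infdist_le:
  fixes C :: "'a::euclidean_space set"
  assumes "C \<in> convex_bodies"
  shows "convex {x. infdist x C \<le> r}"
proof (cases "0 \<le> r")
  case False
  then have "{x. infdist x C \<le> r} = {}"
    by (auto simp: not_le intro: less_le_trans[OF _ infdist_nonneg])
  then show ?thesis by simp
next
  case True
  have C: "closed C" "C \<noteq> {}" "convex C"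
    using assms by (auto simp: convex_bodies_def compact_imp_closed)
  have "{x. infdist x C \<le> r} = (\<Union>x\<in>C. \<Union>y\<in>cball 0 r. {x + y})"
  proof (intro equalityI subsetI)
    fix x assume "x \<in> {x. infdist x C \<le> r}"
    moreover obtain y where "y \<in> C" "infdist x C = dist x y"
      using C infdist_attains_inf by metis
    ultimately have "x = y + (x - y)" "y \<in> C" "x - y \<in> cball 0 r"
      by (auto simp: dist_norm norm_minus_commute)
    then show "x \<in> (\<Union>x\<in>C. \<Union>y\<in>cball 0 r. {x + y})" by blast
  next
    fix w assume "w \<in> (\<Union>x\<in>C. \<Union>y\<in>cball 0 r. {x + y})"
    then obtain x y where "w = x + y" "x \<in> C" "norm y \<le> r" by auto
    then show "w \<in> {x. infdist x C \<le> r}"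
      using infdist_le[of x C w] by (simp add: dist_norm)
  qed
  then show ?thesis
    using convex_sums[OF C(3) convex_cball[of 0 r]] by simp
qed

text \<open>Convex hulls of finite subsets of a countable dense set \<open>Q\<close> do the job: the
  points of a finite \<open>e/2\<close>-net of \<open>C\<close> are moved into \<open>Q\<close> by
  less than \<open>e/2\<close>. Then \<open>C\<close> lies within \<open>e\<close> of the hull
  through the net, and the hull lies within \<open>e\<close> of \<open>C\<close> because the
  \<open>e\<close>-neighbourhood of \<open>C\<close> is convex.\<close>

lemma countable_dense_convex_bodies:
  obtains D :: "'a::euclidean_space set set"
  where "countable D" "D \<subseteq> convex_bodies"
    "\<And>C e. C \<in> convex_bodies \<Longrightarrow> 0 < e \<Longrightarrow> \<exists>K\<in>D. hausdist C K \<le> e"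
proof -
  obtain Q :: "'a set" where Q: "countable Q" "\<And>X. open X \<Longrightarrow> X \<noteq> {} \<Longrightarrow> \<exists>d\<in>Q. d \<in> X"
    by (rule countable_dense_setE) blast
  define D where "D = (\<lambda>T. convex hull T) ` {T. finite T \<and> T \<subseteq> Q \<and> T \<noteq> {}}"
  have "countable {T. finite T \<and> T \<subseteq> Q \<and> T \<noteq> {}}"
    by (rule countable_subset[OF _ countable_Collect_finite_subset[OF Q(1)]]) auto
  then have "countable D" by (simp add: D_def)
  moreover have "D \<subseteq> convex_bodies"
    by (auto simp: D_def intro: hull_finite_mem_convex_bodies)
  moreover have "\<exists>K\<in>D. hausdist C K \<le> e" if C: "C \<in> convex_bodies" and e: "0 < e" for C e
  proof -
    have Cp: "compact C" "C \<noteq> {}" using C by (auto simp: convex_bodies_def)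
    obtain F where F: "finite F" "F \<subseteq> C" "C \<subseteq> (\<Union>x\<in>F. ball x (e/2))"
    proof (rule compactE_image[OF Cp(1), of C "\<lambda>x. ball x (e/2)"])
      show "C \<subseteq> (\<Union>c\<in>C. ball c (e/2))" using e by (auto intro!: bexI)
    qed auto
    have "\<exists>q\<in>Q. q \<in> ball x (e/2)" for x
      using Q(2)[of "ball x (e/2)"] e by auto
    then obtain q where q: "\<And>x. q x \<in> Q" "\<And>x. dist x (q x) < e/2" by (metis mem_ball)
    let ?K = "convex hull (q ` F)"
    have Fne: "F \<noteq> {}" using F Cp by auto
    have "?K \<in> D" using F(1) Fne q by (auto simp: D_def)
    moreover have K: "?K \<in> convex_bodies"
      using F(1) Fne by (simp add: hull_finite_mem_convex_bodies)
    have "hausdist C ?K \<le> e"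
      unfolding hausdist_le_iff[OF C K]
    proof (intro conjI ballI)
      fix x assume "x \<in> C"
      then obtain y where y: "y \<in> F" "dist y x < e/2" using F(3) by auto
      have "infdist x ?K \<le> dist x (q y)"
        using y by (intro infdist_le hull_inc) auto
      also have "\<dots> \<le> e" using y q(2)[of y] dist_triangle[of x "q y" y] by (simp add: dist_commute)
      finally show "infdist x ?K \<le> e" .
    next
      have "?K \<subseteq> {y. infdist y C \<le> e}"
      proof (rule hull_minimal)
        have "infdist (q x) C \<le> e" if "x \<in> F" for x
          using infdist_le[of x C "q x"] that F(2) q(2)[of x] e by (auto simp: dist_commute)
        then show "q ` F \<subseteq> {y. infdist y C \<le> e}" by auto
      qed (rule convex_infdist_le[OF C])
      then show "infdist y C \<le> e" if "y \<in> ?K" for y using that by auto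
    qed
    ultimately show ?thesis by blast
  qed
  ultimately show thesis by (rule that)
qed

lemma countable_base_convex_bodies:
  obtains B :: "'a::euclidean_space set set set"
  where "countable B" "\<And>V. V \<in> B \<Longrightarrow> openin hausdist.mtopology V"
    "\<And>G C. openin hausdist.mtopology G \<Longrightarrow> C \<in> G \<Longrightarrow> \<exists>V\<in>B. C \<in> V \<and> V \<subseteq> G"
proof -
  obtain D :: "'a set set" where D: "countable D" "D \<subseteq> convex_bodies"
    "\<And>C e. C \<in> convex_bodies \<Longrightarrow> 0 < e \<Longrightarrow> \<exists>K\<in>D. hausdist C K \<le> e"
    by (rule countable_dense_convex_bodies) blast
  define B where "B = (\<lambda>(K, k::nat). hausdist.mball K (1 / real (Suc k))) ` (D \<times> UNIV)"
  have "\<exists>V\<in>B. C \<in> V \<and> V \<subseteq> G" if G: "openin hausdist.mtopology G" and C: "C \<in> G" for G C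
  proof -
    obtain r where r: "0 < r" "hausdist.mball C r \<subseteq> G"
      using G C unfolding hausdist.openin_mtopology by blast
    have CK: "C \<in> convex_bodies" using G C openin_subset by fastforce
    obtain k where k: "1 / real (Suc k) < r / 2" using r(1) nat_approx_posE[of "r/2"] by auto
    \<comment> \<open>Half of the radius is requested because density yields only a weak inequality,
      while the ball around \<open>K\<close> must contain \<open>C\<close> strictly.\<close>
    obtain K where K: "K \<in> D" "hausdist C K \<le> 1 / real (Suc k) / 2"
      using D(3)[OF CK, of "1 / real (Suc k) / 2"] by auto
    have pos: "0 < 1 / real (Suc k)" by simp
    have "C \<in> hausdist.mball K (1 / real (Suc k))"
    proof -
      have "e / 2 < e" if "0 < e" for e :: real using that by simp
      from le_less_trans[OF K(2) this[OF pos]] have "hausdist K C < 1 / real (Suc k)"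
        by (simp only: hausdist_commute[of C K])
      then show ?thesis using K(1) D(2) CK by (subst hausdist.in_mball) auto
    qed
    moreover have "hausdist.mball K (1 / real (Suc k)) \<subseteq> hausdist.mball C r"
    proof
      fix L assume L: "L \<in> hausdist.mball K (1 / real (Suc k))"
      then have "hausdist C L \<le> hausdist C K + hausdist K L"
        using hausdist.triangle[of C K L] CK D(2) K by auto
      moreover have "e / 2 < e" if "0 < e" for e :: real using that by simp
      from le_less_trans[OF K(2) this[OF pos]] have "hausdist C K < 1 / real (Suc k)" .
      moreover have "hausdist K L < 1 / real (Suc k)" using L by simp
      ultimately have "hausdist C L < r" using k by linarith
      then show "L \<in> hausdist.mball C r" using L CK by simp
    qed
    ultimately show ?thesis using r(2) K(1) by (force simp: B_def)
  qed
  then show thesis using D(1) by (intro that[of B]) (auto simp: B_def)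
qed

section \<open>Local finiteness and measurability of the number of cells in a Borel set of
  bodies\<close>

text \<open>A localising family: hitting an open ball is an open condition on a body, a tessellation
  has only finitely many cells in each member, and the members increase to the whole space of convex
  bodies.\<close>

definition meeting_ball :: "nat \<Rightarrow> 'a::euclidean_space set set" where
  "meeting_ball k = {C \<in> convex_bodies. C \<inter> ball 0 (real k) \<noteq> {}}"

lemma openin_meeting_ball: "openin hausdist.mtopology (meeting_ball k)"
  unfolding hausdist.openin_mtopology
proof (intro conjI allI impI)
  fix C :: "'a set" assume "C \<in> meeting_ball k"
  then obtain x where C: "C \<in> convex_bodies" "x \<in> C" "norm x < real k"
    by (auto simp: meeting_ball_def)
  have "hausdist.mball C (real k - norm x) \<subseteq> meeting_ball k"
  proof
    fix D assume "D \<in> hausdist.mball C (real k - norm x)"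
    then have D: "D \<in> convex_bodies" "hausdist C D < real k - norm x" by auto
    have "closed D" "D \<noteq> {}" using D(1) by (auto simp: convex_bodies_def compact_imp_closed)
    then obtain y where y: "y \<in> D" "infdist x D = dist x y" by (rule infdist_attains_inf)
    have "dist x y < real k - norm x"
      using infdist_le_hausdist[OF C(1) D(1) C(2)] y D by simp
    moreover have "norm y \<le> norm x + dist x y"
      by (metis dist_norm norm_minus_commute norm_triangle_sub)
    ultimately have "norm y < real k" by linarith
    then show "D \<in> meeting_ball k" using D y by (auto simp: meeting_ball_def)
  qed
  then show "\<exists>r>0. hausdist.mball C r \<subseteq> meeting_ball k" using C by (intro exI[of _ "real k - norm x"]) auto
qed (auto simp: meeting_ball_def)

lemma finite_Int_meeting_ball:
  assumes "m \<in> tessellations"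
  shows "finite (m \<inter> meeting_ball k)"
proof -
  have "finite {C \<in> m. C \<inter> ball 0 (real k) \<noteq> {}}"
    using assms bounded_ball unfolding tessellations_def by blast
  then show ?thesis by (rule rev_finite_subset) (auto simp: meeting_ball_def)
qed

lemma space_convex_body_borel [simp]: "space convex_body_borel = convex_bodies"
  by (simp add: convex_body_borel_def borel_of_topology_def space_measure_of_conv)

lemma sets_convex_body_borel:
  "sets convex_body_borel = sigma_sets convex_bodies {U. openin hausdist.mtopology U}"
proof -
  have "{U. openin hausdist.mtopology U} \<subseteq> Pow (convex_bodies :: 'a set set)"
    using openin_subset by fastforce
  then show ?thesis by (simp add: convex_body_borel_def borel_of_topology_def)
qed

text \<open>The entry point from the Fell topology. Closedness, which is part of the generating set,
  holds for every tessellation by \<open>tessellation_closedin\<close>.\<close>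

lemma open_hit_sets:
  assumes "openin hausdist.mtopology G"
  shows "{m \<in> tessellations. m \<inter> G \<noteq> {}} \<in> sets tessellation_algebra"
proof -
  let ?H = "{F. closedin hausdist.mtopology F \<and> F \<inter> G \<noteq> {}}"
  have "openin (fell_topology hausdist.mtopology) ?H"
    unfolding fell_topology_def using assms by (intro topology_generated_by_Basis) blast
  then have "?H \<in> sets (borel_of_topology (fell_topology hausdist.mtopology))"
    using openin_subset unfolding borel_of_topology_def by (subst sets_measure_of) auto
  moreover have "{m \<in> tessellations. m \<inter> G \<noteq> {}} = tessellations \<inter> ?H"
    using tessellation_closedin by auto
  ultimately show ?thesis
    unfolding tessellation_algebra_def sets_restrict_space by blast
qed

lemma separate_finite:
  fixes S :: "'a::euclidean_space set set"
  assumes "finite S" "S \<subseteq> convex_bodies"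
  shows "\<exists>r>0. \<forall>C\<in>S. \<forall>D\<in>S. C \<noteq> D \<longrightarrow> disjnt (hausdist.mball C r) (hausdist.mball D r)"
proof -
  \<comment> \<open>Half of the least pairwise distance; the extra entry 1 keeps \<open>Min\<close>
    meaningful when \<open>S\<close> has at most one element.\<close>
  define r where "r = Min (insert 1 ((\<lambda>(C,D). hausdist C D / 2) ` {(C,D)\<in>S\<times>S. C \<noteq> D}))"
  have fin: "finite {(C,D)\<in>S\<times>S. C \<noteq> D}"
    by (rule finite_subset[of _ "S\<times>S"]) (use assms in auto)
  have "0 < hausdist C D" if "C \<in> S" "D \<in> S" "C \<noteq> D" for C D
    using hausdist.mdist_pos_eq[of C D] that assms(2) by blast
  then have "0 < r" using fin by (auto simp: r_def)
  moreover have "disjnt (hausdist.mball C r) (hausdist.mball D r)"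
    if CD: "C \<in> S" "D \<in> S" "C \<noteq> D" for C D
  proof -
    have "r \<le> hausdist C D / 2"
      unfolding r_def using fin CD by (intro Min_le) (auto simp: image_iff)
    moreover have False if "E \<in> hausdist.mball C r" "E \<in> hausdist.mball D r" for E
      using that hausdist.triangle[of C E D] calculation by (auto simp: hausdist_commute)
    ultimately show ?thesis by (auto simp: disjnt_iff)
  qed
  ultimately show ?thesis by blast
qed

text \<open>A locally finite configuration has at least \<open>j\<close> points in an open set \<open>V\<close> iff \<open>j\<close> pairwise
  disjoint basic open subsets of \<open>V\<close> are hit.\<close>

lemma card_ge_open_sets:
  fixes V :: "'a::euclidean_space set set"
  assumes V: "openin hausdist.mtopology V"
    and fin: "\<And>m. m \<in> tessellations \<Longrightarrow> finite (m \<inter> V)"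
  shows "{m \<in> tessellations. j \<le> card (m \<inter> V)} \<in> sets tessellation_algebra"
proof -
  obtain B :: "'a set set set" where B: "countable B"
    "\<And>U. U \<in> B \<Longrightarrow> openin hausdist.mtopology U"
    "\<And>G C. openin hausdist.mtopology G \<Longrightarrow> C \<in> G \<Longrightarrow> \<exists>U\<in>B. C \<in> U \<and> U \<subseteq> G"
    by (rule countable_base_convex_bodies) blast
  define \<F> where "\<F> = {F. finite F \<and> F \<subseteq> B \<and> card F = j \<and> pairwise disjnt F \<and> \<Union>F \<subseteq> V}"
  have "countable \<F>"
    by (rule countable_subset[OF _ countable_Collect_finite_subset[OF B(1)]]) (auto simp: \<F>_def)
  \<comment> \<open>For \<open>F = {}\<close>, the case \<open>j = 0\<close>, the intersection over
    \<open>F\<close> is \<open>UNIV\<close>; meeting it with \<open>tessellations\<close> keeps that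
    case correct.\<close>
  moreover have "(\<Inter>U\<in>F. {m \<in> tessellations. m \<inter> U \<noteq> {}}) \<inter> tessellations \<in> sets tessellation_algebra"
    if "F \<in> \<F>" for F
  proof (cases "F = {}")
    case True
    then show ?thesis using sets.top[of tessellation_algebra] by (simp add: space_tessellation_algebra)
  next
    case False
    then show ?thesis using that B(2) sets.top[of tessellation_algebra]
      by (intro sets.Int sets.finite_INT open_hit_sets)
        (auto simp: \<F>_def space_tessellation_algebra)
  qed
  ultimately have "(\<Union>F\<in>\<F>. (\<Inter>U\<in>F. {m \<in> tessellations. m \<inter> U \<noteq> {}}) \<inter> tessellations)
      \<in> sets tessellation_algebra"
    by (intro sets.countable_UN') auto
  also have "(\<Union>F\<in>\<F>. (\<Inter>U\<in>F. {m \<in> tessellations. m \<inter> U \<noteq> {}}) \<inter> tessellations)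
      = {m \<in> tessellations. j \<le> card (m \<inter> V)}"
  proof (intro equalityI subsetI)
    fix m assume "m \<in> (\<Union>F\<in>\<F>. (\<Inter>U\<in>F. {m \<in> tessellations. m \<inter> U \<noteq> {}}) \<inter> tessellations)"
    then obtain F where F: "F \<in> \<F>" "m \<in> tessellations" "\<And>U. U \<in> F \<Longrightarrow> \<exists>C. C \<in> m \<inter> U"
      by blast
    then obtain c where c: "\<And>U. U \<in> F \<Longrightarrow> c U \<in> m \<inter> U" by metis
    have "inj_on c F"
    proof (rule inj_onI, rule ccontr)
      fix U U' assume "U \<in> F" "U' \<in> F" "c U = c U'" "U \<noteq> U'"
      moreover from this have "disjnt U U'" using F(1) by (auto simp: \<F>_def pairwise_def)
      ultimately show False using c[of U] c[of U'] by (auto simp: disjnt_iff)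
    qed
    moreover have "c ` F \<subseteq> m \<inter> V" using c F(1) by (fastforce simp: \<F>_def)
    ultimately have "card F \<le> card (m \<inter> V)" using fin[OF F(2)] by (metis card_inj_on_le)
    then show "m \<in> {m \<in> tessellations. j \<le> card (m \<inter> V)}" using F by (auto simp: \<F>_def)
  next
    fix m assume "m \<in> {m \<in> tessellations. j \<le> card (m \<inter> V)}"
    then have m: "m \<in> tessellations" "j \<le> card (m \<inter> V)" by auto
    then obtain S where S: "S \<subseteq> m \<inter> V" "card S = j" "finite S"
      by (metis obtain_subset_with_card_n fin finite_subset)
    then have "S \<subseteq> convex_bodies" using m by (auto simp: tessellations_def)
    then obtain r where r: "r > 0"
      "\<And>C D. C \<in> S \<Longrightarrow> D \<in> S \<Longrightarrow> C \<noteq> D \<Longrightarrow> disjnt (hausdist.mball C r) (hausdist.mball D r)"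
      using separate_finite[OF S(3)] by blast
    \<comment> \<open>Basic sets chosen inside the separating balls are automatically disjoint, so
      \<open>j\<close> distinct cells give \<open>j\<close> distinct members of a family in
      \<open>\<F>\<close>.\<close>
    have "\<exists>U\<in>B. C \<in> U \<and> U \<subseteq> hausdist.mball C r \<inter> V" if "C \<in> S" for C
      using that S(1) V r(1) \<open>S \<subseteq> convex_bodies\<close>
      by (intro B(3)) (auto intro!: openin_Int hausdist.openin_mball)
    then obtain u where u: "\<And>C. C \<in> S \<Longrightarrow> u C \<in> B \<and> C \<in> u C \<and> u C \<subseteq> hausdist.mball C r \<inter> V"
      by metis
    have dis: "disjnt (u C) (u D)" if "C \<in> S" "D \<in> S" "C \<noteq> D" for C D
      using r(2)[OF that] u[OF that(1)] u[OF that(2)] unfolding disjnt_iff by blast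
    have "inj_on u S"
    proof (rule inj_onI, rule ccontr)
      fix C D assume CD: "C \<in> S" "D \<in> S" "u C = u D" "C \<noteq> D"
      then show False using dis[of C D] u[of C] by (auto simp: disjnt_iff)
    qed
    then have "u ` S \<in> \<F>"
    proof -
      have "pairwise disjnt (u ` S)" using dis by (auto simp: pairwise_def)
      moreover have "u ` S \<subseteq> B" "\<Union>(u ` S) \<subseteq> V" using u by blast+
      ultimately show ?thesis using S \<open>inj_on u S\<close> by (simp add: \<F>_def card_image)
    qed
    moreover have "m \<inter> U \<noteq> {}" if "U \<in> u ` S" for U using that u S(1) by blast
    ultimately show "m \<in> (\<Union>F\<in>\<F>. (\<Inter>U\<in>F. {m \<in> tessellations. m \<inter> U \<noteq> {}}) \<inter> tessellations)"
      using m(1) by blast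
  qed
  finally show ?thesis .
qed

text \<open>A Dynkin class argument over the intersection-stable generator of open sets. Complements
  turn into differences of counts, which is legitimate because counts inside
  \<open>meeting_ball k\<close> are finite; this is the reason for localising.\<close>

lemma measurable_cell_count_local:
  assumes "S \<in> sets convex_body_borel"
  shows "(\<lambda>m. emeasure (count_space UNIV) (m \<inter> meeting_ball k \<inter> S)) \<in> borel_measurable tessellation_algebra"
proof -
  let ?U = "meeting_ball k :: 'a set set"
  let ?c = "\<lambda>S (m :: 'a set set). emeasure (count_space UNIV) (m \<inter> ?U \<inter> S)"
  have open_case: "?c G \<in> borel_measurable tessellation_algebra" if G: "openin hausdist.mtopology G" for G
  proof -
    have V: "openin hausdist.mtopology (?U \<inter> G)" using G openin_meeting_ball by blast
    have fin: "finite (m \<inter> (?U \<inter> G))" if "m \<in> tessellations" for m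
      using finite_Int_meeting_ball[OF that, of k] by (rule rev_finite_subset) auto
    have "(\<lambda>m. card (m \<inter> (?U \<inter> G))) \<in> measurable tessellation_algebra (count_space UNIV)"
    proof (subst measurable_count_space_eq2_countable, safe)
      fix j
      have "(\<lambda>m. card (m \<inter> (?U \<inter> G))) -` {j} \<inter> space tessellation_algebra =
        {m \<in> tessellations. j \<le> card (m \<inter> (?U \<inter> G))} - {m \<in> tessellations. Suc j \<le> card (m \<inter> (?U \<inter> G))}"
        by (auto simp: space_tessellation_algebra)
      then show "(\<lambda>m. card (m \<inter> (?U \<inter> G))) -` {j} \<inter> space tessellation_algebra \<in> sets tessellation_algebra"
        using card_ge_open_sets[OF V fin] by (simp add: sets.Diff)
    qed auto
    from measurable_compose[OF this, of of_nat borel]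
    have meas: "(\<lambda>m. of_nat (card (m \<inter> (?U \<inter> G))) :: ennreal) \<in> borel_measurable tessellation_algebra" by simp
    have "?c G m = of_nat (card (m \<inter> (?U \<inter> G)))" if "m \<in> space tessellation_algebra" for m
      using fin[of m] that by (simp add: space_tessellation_algebra Int_assoc emeasure_count_space_finite)
    then show ?thesis by (rule measurable_cong[THEN iffD2, OF _ meas])
  qed
  have *: "Int_stable {U. openin hausdist.mtopology (U :: 'a set set)}"
    "{U. openin hausdist.mtopology U} \<subseteq> Pow (convex_bodies :: 'a set set)"
    using openin_subset[of hausdist.mtopology] by (auto simp: Int_stable_def)
  show ?thesis
    using * assms[unfolded sets_convex_body_borel]
  proof (induction rule: sigma_sets_induct_disjoint)
    case (basic G)
    then show ?case using open_case by blast
  next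
    case empty
    then show ?case by simp
  next
    case (compl S)
    have diff: "?c (convex_bodies - S) m = ?c convex_bodies m - ?c S m" if "m \<in> tessellations" for m
    proof -
      have S: "S \<subseteq> convex_bodies"
        using compl(1) sigma_sets_into_sp[OF *(2)] by blast
      have "m \<inter> ?U \<inter> (convex_bodies - S) = (m \<inter> ?U \<inter> convex_bodies) - (m \<inter> ?U \<inter> S)"
        by auto
      moreover have "emeasure (count_space UNIV) (m \<inter> ?U \<inter> S) \<noteq> \<infinity>"
        using finite_subset[OF Int_lower1 finite_Int_meeting_ball[OF that, of k], of S]
        by (simp add: emeasure_count_space_finite)
      moreover have "m \<inter> ?U \<inter> S \<subseteq> m \<inter> ?U \<inter> convex_bodies" using S by blast
      ultimately show ?thesis by (simp only:) (rule emeasure_Diff, simp_all)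
    qed
    have "openin hausdist.mtopology (convex_bodies :: 'a set set)"
      using openin_topspace[of hausdist.mtopology] by simp
    from borel_measurable_minus_ennreal[OF open_case[OF this] compl(2)]
    show ?case
      by (rule measurable_cong[THEN iffD2, rotated]) (simp add: diff space_tessellation_algebra)
  next
    case (union A)
    have "?c (\<Union>(range A)) m = (\<Sum>i. ?c (A i) m)" for m
    proof -
      have "m \<inter> ?U \<inter> \<Union>(range A) = (\<Union>i. m \<inter> ?U \<inter> A i)" by auto
      then show ?thesis
        using union(1) by (subst suminf_emeasure) (auto simp: disjoint_family_on_def)
    qed
    then show ?case using union(3) by simp
  qed
qed

text \<open>Monotone limit of the local counts: a convex body is nonempty, hence hits some ball
  around the origin. The value may be infinite here.\<close>

lemma measurable_cell_count:
  assumes "S \<in> sets convex_body_borel"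
  shows "(\<lambda>m. emeasure (count_space UNIV) (m \<inter> S)) \<in> borel_measurable tessellation_algebra"
proof -
  have S: "S \<subseteq> convex_bodies" using sets.sets_into_space[OF assms] by simp
  have eq: "emeasure (count_space UNIV) (m \<inter> S) =
    (SUP k. emeasure (count_space UNIV) (m \<inter> meeting_ball k \<inter> S))" for m
  proof -
    have "m \<inter> S = (\<Union>k. m \<inter> meeting_ball k \<inter> S)"
    proof (intro equalityI subsetI)
      fix C assume C: "C \<in> m \<inter> S"
      then obtain x where "x \<in> C" "C \<in> convex_bodies" using S by (auto simp: convex_bodies_def)
      moreover obtain k where "norm x < real k" using reals_Archimedean2 by blast
      ultimately show "C \<in> (\<Union>k. m \<inter> meeting_ball k \<inter> S)"
        using C by (auto simp: meeting_ball_def intro!: exI[of _ k])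
    qed auto
    moreover have "incseq (\<lambda>k. m \<inter> meeting_ball k \<inter> S)"
    proof (rule incseq_SucI)
      fix k show "m \<inter> meeting_ball k \<inter> S \<subseteq> m \<inter> meeting_ball (Suc k) \<inter> S"
        using subset_ball[of "real k" "real (Suc k)" "0 :: 'a"] unfolding meeting_ball_def by auto
    qed
    ultimately show ?thesis by (simp add: SUP_emeasure_incseq)
  qed
  have "(\<lambda>m. SUP k. emeasure (count_space UNIV) (m \<inter> meeting_ball k \<inter> S))
      \<in> borel_measurable tessellation_algebra"
    using measurable_cell_count_local[OF assms] by (intro borel_measurable_SUP) auto
  then show ?thesis by (rule measurable_cong[THEN iffD2, OF eq])
qed

section \<open>Exceedances and the typical cell\<close>

locale typical_cell_model =
  fixes M :: "'w measure" and \<mm> :: "'w \<Rightarrow> 'a::euclidean_space set set"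
    and z :: "'a set \<Rightarrow> 'a" and N :: "'v measure" and X :: "'v \<Rightarrow> 'a set"
    and f :: "'a set \<Rightarrow> real"
  assumes tess: "random_tessellation M \<mm>" "stationary M \<mm>"
    and nucleus: "nucleus_map z"
    and intensity: "has_intensity M \<mm> z 1"
    and typical: "typical_cell M \<mm> z N X"
    and f: "translation_invariant f" "f \<in> borel_measurable convex_body_borel"
begin

sublocale M: prob_space M
  using tess by (simp add: random_tessellation_def)

sublocale N: prob_space N
  using typical by (simp add: typical_cell_def)

lemma measurable_tessellation: "\<mm> \<in> measurable M tessellation_algebra"
  using tess by (simp add: random_tessellation_def)

lemma tessellationD: "\<omega> \<in> space M \<Longrightarrow> \<mm> \<omega> \<in> tessellations"
  using measurable_space[OF measurable_tessellation] by (simp add: space_tessellation_algebra)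

definition marked :: "real set \<Rightarrow> 'a set \<Rightarrow> 'a set set" where
  "marked T B = {C \<in> convex_bodies. z C \<in> B \<and> f C \<in> T}"

text \<open>The value set \<open>T\<close> is left general because two kinds occur: half-lines above
  one threshold, and half-open intervals between two thresholds.\<close>

definition exceedance :: "real set \<Rightarrow> 'a set \<Rightarrow> 'w set" where
  "exceedance T B = {\<omega> \<in> space M. \<exists>C\<in>\<mm> \<omega>. z C \<in> B \<and> f C \<in> T}"

lemma marked_sets:
  assumes "T \<in> sets borel" "B \<in> sets borel"
  shows "marked T B \<in> sets convex_body_borel"
proof -
  have "z -` B \<inter> space convex_body_borel \<in> sets convex_body_borel"
    "f -` T \<inter> space convex_body_borel \<in> sets convex_body_borel"
    using nucleus f(2) assms unfolding nucleus_map_def by (blast intro: measurable_sets)+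
  moreover have "marked T B = (z -` B \<inter> space convex_body_borel) \<inter> (f -` T \<inter> space convex_body_borel)"
    by (auto simp: marked_def)
  ultimately show ?thesis by auto
qed

lemma hit_marked_iff:
  assumes "m \<in> tessellations"
  shows "(\<exists>C\<in>m. z C \<in> B \<and> f C \<in> T) \<longleftrightarrow> emeasure (count_space UNIV) (m \<inter> marked T B) \<noteq> 0"
  using assms by (auto simp: emeasure_count_space_eq_0 marked_def tessellations_def)

lemma hit_sets:
  assumes "T \<in> sets borel" "B \<in> sets borel"
  shows "{m \<in> tessellations. \<exists>C\<in>m. z C \<in> B \<and> f C \<in> T} \<in> sets tessellation_algebra"
proof -
  let ?c = "\<lambda>m. emeasure (count_space UNIV) (m \<inter> marked T B)"
  have "?c -` (- {0}) \<inter> space tessellation_algebra \<in> sets tessellation_algebra"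
    by (rule measurable_sets[OF measurable_cell_count[OF marked_sets[OF assms]]]) auto
  also have "?c -` (- {0}) \<inter> space tessellation_algebra =
    {m \<in> tessellations. \<exists>C\<in>m. z C \<in> B \<and> f C \<in> T}"
    using hit_marked_iff[of _ B T] unfolding space_tessellation_algebra by blast
  finally show ?thesis .
qed

lemma exceedance_vimage:
  "exceedance T B = \<mm> -` {m \<in> tessellations. \<exists>C\<in>m. z C \<in> B \<and> f C \<in> T} \<inter> space M"
  using tessellationD by (auto simp: exceedance_def)

lemma exceedance_sets [measurable]:
  assumes "T \<in> sets borel" "B \<in> sets borel"
  shows "exceedance T B \<in> sets M"
  unfolding exceedance_vimage by (rule measurable_sets[OF measurable_tessellation hit_sets[OF assms]])

text \<open>Shifting the tessellation by \<open>-x\<close> moves every nucleus by \<open>-x\<close>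
  and leaves the values of \<open>f\<close> unchanged, so the shifted tessellation has a marked cell
  over \<open>B\<close> exactly when the original one has a marked cell over \<open>B\<close> moved
  by \<open>x\<close>. Stationarity then equates the probabilities.\<close>

lemma exceedance_translate:
  assumes T: "T \<in> sets borel" and B: "B \<in> sets borel"
  shows "M.prob (exceedance T ((+) x ` B)) = M.prob (exceedance T B)"
proof -
  let ?H = "{m \<in> tessellations. \<exists>C\<in>m. z C \<in> B \<and> f C \<in> T}"
  let ?t = "\<lambda>\<omega>. translate (- x) ` \<mm> \<omega>"
  have shift: "distr M tessellation_algebra ?t = distr M tessellation_algebra \<mm>"
    using tess(2) by (simp add: stationary_def)
  have "(+) x ` B = (\<lambda>y. - x + y) -` B \<inter> space borel"
  proof (intro equalityI subsetI)
    fix y assume "y \<in> (\<lambda>y. - x + y) -` B \<inter> space borel"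
    then show "y \<in> (+) x ` B" by (intro image_eqI[of _ _ "- x + y"]) auto
  qed auto
  also have "\<dots> \<in> sets borel" using B by (intro measurable_sets[of _ borel borel]) auto
  finally have B': "(+) x ` B \<in> sets borel" .
  have trans: "translate (- x) C \<in> convex_bodies" "z (translate (- x) C) = z C - x"
    "f (translate (- x) C) = f C" if "C \<in> convex_bodies" for C
  proof -
    show "translate (- x) C \<in> convex_bodies"
      using that compact_translation[of C "- x"] convex_translation[of C "- x"]
      unfolding convex_bodies_def translate_def by blast
    show "z (translate (- x) C) = z C - x" "f (translate (- x) C) = f C"
      using that nucleus f(1) by (simp_all add: nucleus_map_def translation_invariant_def)
  qed
  \<comment> \<open>Membership in \<open>tessellations\<close> is part of \<open>?H\<close>, so the
    preimage of \<open>?H\<close> under the shift can be computed only once translates are known to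
    be tessellations.\<close>
  have tb: "translate (- x) ` m \<in> tessellations" if m: "m \<in> tessellations" for m
  proof -
    have "translate (- x) ` m \<subseteq> convex_bodies"
      using trans(1) m by (auto simp: tessellations_def)
    moreover have "pairwise (\<lambda>C D. interior C \<inter> interior D = {}) (translate (- x) ` m)"
    proof -
      have "interior (translate (- x) C) \<inter> interior (translate (- x) D) = {}"
        if "interior C \<inter> interior D = {}" for C D :: "'a set"
        unfolding translate_def interior_translation image_Int[OF inj_on_add, symmetric] that by simp
      moreover have "interior C \<inter> interior D = {}" if "C \<in> m" "D \<in> m" "C \<noteq> D" for C D
        using m that by (auto simp: tessellations_def pairwise_def)
      ultimately show ?thesis by (fastforce simp: pairwise_def)
    qed
    moreover have "\<Union>(translate (- x) ` m) = UNIV"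
    proof -
      have "\<Union>(translate (- x) ` m) = (+) (- x) ` \<Union>m" unfolding translate_def by blast
      also have "\<dots> = UNIV" using m surj_plus[of "- x"] by (simp add: tessellations_def)
      finally show ?thesis .
    qed
    moreover have "finite {D \<in> translate (- x) ` m. D \<inter> A \<noteq> {}}" if "bounded A" for A
    proof -
      have "bounded ((+) x ` A)" using that by (rule bounded_translation)
      then have "finite {C \<in> m. C \<inter> (+) x ` A \<noteq> {}}" using m by (auto simp: tessellations_def)
      moreover have "{D \<in> translate (- x) ` m. D \<inter> A \<noteq> {}} \<subseteq>
          translate (- x) ` {C \<in> m. C \<inter> (+) x ` A \<noteq> {}}"
        by (force simp: translate_def)
      ultimately show ?thesis by (meson finite_imageI finite_subset)
    qed
    ultimately show ?thesis using m by (auto simp: tessellations_def)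
  qed
  have vimage: "?t -` ?H \<inter> space M = exceedance T ((+) x ` B)"
  proof -
    have shift_mem: "y - x \<in> B \<longleftrightarrow> y \<in> (+) x ` B" for y
      by (auto intro!: image_eqI[of _ _ "y - x"])
    have iff: "\<omega> \<in> ?t -` ?H \<longleftrightarrow> (\<exists>C\<in>\<mm> \<omega>. z C \<in> (+) x ` B \<and> f C \<in> T)" if "\<omega> \<in> space M" for \<omega>
    proof -
      have "C \<in> convex_bodies" if "C \<in> \<mm> \<omega>" for C
        using tessellationD[OF \<open>\<omega> \<in> space M\<close>] that by (auto simp: tessellations_def)
      then show ?thesis
        using tb[OF tessellationD[OF that]] by (simp add: trans shift_mem cong: bex_cong_simp)
    qed
    show ?thesis
      by (rule set_eqI) (simp only: exceedance_def Int_iff mem_Collect_eq iff conj_commute cong: conj_cong)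
  qed
  \<comment> \<open>\<^const>\<open>distr\<close> along a map that is not known to be measurable is the zero measure unless the
    image set function is a measure; equality with the law of \<open>\<mm>\<close> rules out the former.\<close>
  let ?\<mu> = "\<lambda>A. emeasure M (?t -` A \<inter> space M)"
  have conv: "emeasure (distr M tessellation_algebra ?t) A =
      (if measure_space (space tessellation_algebra) (sets tessellation_algebra) ?\<mu> then ?\<mu> A else 0)"
    if "A \<in> sets tessellation_algebra" for A
    using that unfolding distr_def emeasure_measure_of_conv by (simp add: sets.sigma_sets_eq)
  have "emeasure (distr M tessellation_algebra \<mm>) (space tessellation_algebra) = 1"
    using prob_space.emeasure_space_1[OF M.prob_space_distr[OF measurable_tessellation]] by simp
  then have "measure_space (space tessellation_algebra) (sets tessellation_algebra) ?\<mu>"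
    using conv[OF sets.top] unfolding shift by (auto split: if_splits)
  then have "emeasure M (exceedance T ((+) x ` B)) = emeasure (distr M tessellation_algebra \<mm>) ?H"
    using conv[OF hit_sets[OF T B]] by (simp only: shift vimage if_True)
  also have "\<dots> = emeasure M (exceedance T B)"
    unfolding exceedance_vimage by (rule emeasure_distr[OF measurable_tessellation hit_sets[OF T B]])
  finally show ?thesis by (simp add: measure_def)
qed

text \<open>First moment bound: the probability of having a marked cell is at most the mean number
  of marked cells, which the typical cell formula, applied to the indicator of
  \<open>f C \<in> T\<close>, evaluates. Translation invariance of \<open>f\<close> makes the
  recentring of cells in that formula harmless.\<close>

lemma prob_exceedance_le:
  assumes T: "T \<in> sets borel" and B: "B \<in> sets borel" "0 < emeasure lborel B" "emeasure lborel B < \<infinity>"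
  shows "M.prob (exceedance T B) \<le> measure lborel B * \<P>(\<omega> in N. f (X \<omega>) \<in> T)"
proof -
  let ?n = "\<lambda>\<omega>. emeasure (count_space UNIV) (\<mm> \<omega> \<inter> marked UNIV B)"
  let ?Y = "\<lambda>\<omega>. \<Sum>\<^sub>\<infinity>C\<in>cells_in z (\<mm> \<omega>) B. indicat_real {C. f C \<in> T} (translate (- z C) C)"
  have X: "X \<in> measurable N convex_body_borel" using typical by (simp add: typical_cell_def)
  have g: "indicat_real {C. f C \<in> T} \<in> borel_measurable convex_body_borel"
    using f(2) T by measurable
  have pos: "0 < measure lborel B"
    using B(2,3) by (simp add: measure_def enn2real_positive_iff)
  have cells: "cells_in z (\<mm> \<omega>) B = \<mm> \<omega> \<inter> marked UNIV B" if "\<omega> \<in> space M" for \<omega>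
    using tessellationD[OF that] by (auto simp: cells_in_def marked_def tessellations_def)
  have n_meas: "?n \<in> borel_measurable M"
    by (rule measurable_compose[OF measurable_tessellation measurable_cell_count[OF marked_sets]])
      (use B in auto)
  have "(\<integral>\<^sup>+\<omega>. ?n \<omega> \<partial>M) = (\<integral>\<^sup>+\<omega>. emeasure (count_space UNIV) (cells_in z (\<mm> \<omega>) B) \<partial>M)"
    by (intro nn_integral_cong) (simp add: cells)
  also have "\<dots> / emeasure lborel B = 1"
    using intensity B by (simp add: has_intensity_def)
  finally have *: "(\<integral>\<^sup>+\<omega>. ?n \<omega> \<partial>M) / emeasure lborel B = 1" .
  \<comment> \<open>The intensity hypothesis supplies finiteness: an infinite mean divided by a
    finite volume would be infinite, not 1. The Bochner integral in the typical cell formula carries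
    no such information by itself.\<close>
  then have n_fin: "(\<integral>\<^sup>+\<omega>. ?n \<omega> \<partial>M) \<noteq> \<infinity>"
    using B(3) by (auto simp: ennreal_top_divide split: if_splits)
  then have AE_fin: "AE \<omega> in M. ?n \<omega> \<noteq> \<infinity>"
    using nn_integral_PInf_AE[OF n_meas] by simp
  \<comment> \<open>This also holds when infinitely many marked cells lie in \<open>B\<close>: both sides are then 0.\<close>
  have Y: "?Y \<omega> = enn2real (emeasure (count_space UNIV) (\<mm> \<omega> \<inter> marked T B))"
    if \<omega>: "\<omega> \<in> space M" for \<omega>
  proof -
    have f_eq: "f (translate (- z C) C) = f C" if "C \<in> \<mm> \<omega>" for C
      using that f(1) tessellationD[OF \<omega>(1)] by (auto simp: translation_invariant_def tessellations_def)
    have "?Y \<omega> = (\<Sum>\<^sub>\<infinity>C\<in>\<mm> \<omega> \<inter> marked T B. 1)"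
      unfolding cells[OF \<omega>] by (rule infsum_cong_neutral) (auto simp: f_eq marked_def)
    also have "\<dots> = enn2real (emeasure (count_space UNIV) (\<mm> \<omega> \<inter> marked T B))"
      by (cases "finite (\<mm> \<omega> \<inter> marked T B)")
        (simp_all add: emeasure_count_space)
    finally show ?thesis .
  qed
  let ?k = "\<lambda>\<omega>. enn2real (emeasure (count_space UNIV) (\<mm> \<omega> \<inter> marked T B))"
  have k_meas: "?k \<in> borel_measurable M"
    by (intro borel_measurable_enn2real
      measurable_compose[OF measurable_tessellation measurable_cell_count[OF marked_sets[OF T B(1)]]])
  have k_int: "integrable M ?k"
  proof (rule integrableI_bounded[OF k_meas])
    have "(\<integral>\<^sup>+\<omega>. ennreal (norm (?k \<omega>)) \<partial>M) \<le> (\<integral>\<^sup>+\<omega>. ?n \<omega> \<partial>M)"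
    proof (rule nn_integral_mono)
      fix \<omega>
      have "ennreal (norm (?k \<omega>)) \<le> emeasure (count_space UNIV) (\<mm> \<omega> \<inter> marked T B)"
        by (cases "emeasure (count_space UNIV) (\<mm> \<omega> \<inter> marked T B)") auto
      also have "\<dots> \<le> ?n \<omega>" by (intro emeasure_mono) (auto simp: marked_def)
      finally show "ennreal (norm (?k \<omega>)) \<le> ?n \<omega>" .
    qed
    then show "(\<integral>\<^sup>+\<omega>. ennreal (norm (?k \<omega>)) \<partial>M) < \<infinity>" using n_fin by (simp add: top.not_eq_extremum le_less_trans)
  qed
  have "M.prob (exceedance T B) = (\<integral>\<omega>. indicat_real (exceedance T B) \<omega> \<partial>M)"
    using exceedance_sets[OF T B(1)] by simp
  also have "\<dots> \<le> (\<integral>\<omega>. ?k \<omega> \<partial>M)"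
  \<comment> \<open>Where the count is infinite \<open>enn2real\<close> returns 0 and the bound by 1
    could fail; the finite mean makes this a null set.\<close>
  proof (rule integral_mono_AE)
    show "AE \<omega> in M. indicat_real (exceedance T B) \<omega> \<le> ?k \<omega>"
      using AE_fin
    proof (eventually_elim, unfold indicator_def, clarsimp)
      fix \<omega> assume fin: "?n \<omega> \<noteq> top" and \<omega>: "\<omega> \<in> exceedance T B"
      have "finite (\<mm> \<omega> \<inter> marked UNIV B)" using fin by (auto simp: emeasure_count_space split: if_splits)
      then have fin': "finite (\<mm> \<omega> \<inter> marked T B)" by (rule rev_finite_subset) (auto simp: marked_def)
      have "\<mm> \<omega> \<inter> marked T B \<noteq> {}"
        using \<omega> tessellationD[of \<omega>] by (auto simp: exceedance_def marked_def tessellations_def)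
      then have "1 \<le> card (\<mm> \<omega> \<inter> marked T B)" using fin' by (simp add: Suc_leI card_gt_0_iff)
      then show "1 \<le> ?k \<omega>" using fin' by (simp add: emeasure_count_space_finite)
    qed
  qed (use k_int exceedance_sets[OF T B(1)] in \<open>auto simp: integrable_indicator_iff less_top[symmetric]\<close>)
  also have "\<dots> = (\<integral>\<omega>. ?Y \<omega> \<partial>M)"
    by (intro Bochner_Integration.integral_cong) (simp_all add: Y)
  also have "\<dots> = measure lborel B * (\<integral>\<omega>. indicat_real {C. f C \<in> T} (X \<omega>) \<partial>N)"
  proof -
    have "bounded (indicat_real {C. f C \<in> T} ` convex_bodies)"
      by (rule boundedI[of _ 1]) (auto simp: indicator_def)
    then show ?thesis using typical g B pos by (simp add: typical_cell_def)
  qed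
  also have "(\<integral>\<omega>. indicat_real {C. f C \<in> T} (X \<omega>) \<partial>N) = \<P>(\<omega> in N. f (X \<omega>) \<in> T)"
  proof -
    have "(\<lambda>\<omega>. f (X \<omega>)) \<in> borel_measurable N" using measurable_compose[OF X f(2)] .
    then have "{\<omega> \<in> space N. f (X \<omega>) \<in> T} \<in> sets N" using T by measurable
    then have "N.prob {\<omega> \<in> space N. f (X \<omega>) \<in> T} = (\<integral>\<omega>. indicat_real {\<omega> \<in> space N. f (X \<omega>) \<in> T} \<omega> \<partial>N)"
      by simp
    also have "\<dots> = (\<integral>\<omega>. indicat_real {C. f C \<in> T} (X \<omega>) \<partial>N)"
      by (intro Bochner_Integration.integral_cong) (auto simp: indicator_def)
    finally show ?thesis by simp
  qed
  finally show ?thesis .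
qed

end

section \<open>The scaling equation for upper and lower limits\<close>

text \<open>Provides nonnegative rationals with explicit numerators and positive denominators, in
  the form in which the scaling relation can be evaluated at their \<open>d\<close>-th
  powers.\<close>

lemma LIMSEQ_floor_div:
  fixes t :: real
  assumes "0 \<le> t"
  shows "(\<lambda>k. real (nat \<lfloor>t * real (Suc k)\<rfloor>) / real (Suc k)) \<longlonglongrightarrow> t"
proof (rule tendsto_sandwich)
  have bounds: "t * real (Suc k) - 1 \<le> real (nat \<lfloor>t * real (Suc k)\<rfloor>)"
    "real (nat \<lfloor>t * real (Suc k)\<rfloor>) \<le> t * real (Suc k)" for k
  proof -
    have "0 \<le> t * real (Suc k)" using assms by (rule mult_nonneg_nonneg) simp
    then show "t * real (Suc k) - 1 \<le> real (nat \<lfloor>t * real (Suc k)\<rfloor>)"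
      "real (nat \<lfloor>t * real (Suc k)\<rfloor>) \<le> t * real (Suc k)" by linarith+
  qed
  show "\<forall>\<^sub>F k in sequentially. t - 1 / real (Suc k) \<le> real (nat \<lfloor>t * real (Suc k)\<rfloor>) / real (Suc k)"
  proof (intro always_eventually allI)
    fix k
    have "t - 1 / real (Suc k) = (t * real (Suc k) - 1) / real (Suc k)"
      by (simp add: field_simps del: of_nat_Suc)
    also have "\<dots> \<le> real (nat \<lfloor>t * real (Suc k)\<rfloor>) / real (Suc k)"
      by (intro divide_right_mono bounds(1)) simp
    finally show "t - 1 / real (Suc k) \<le> real (nat \<lfloor>t * real (Suc k)\<rfloor>) / real (Suc k)" .
  qed
  show "\<forall>\<^sub>F k in sequentially. real (nat \<lfloor>t * real (Suc k)\<rfloor>) / real (Suc k) \<le> t"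
    using bounds(2) by (intro always_eventually allI) (simp add: pos_divide_le_eq del: of_nat_Suc)
  show "(\<lambda>k. t - 1 / real (Suc k)) \<longlonglongrightarrow> t"
    using tendsto_diff[OF tendsto_const LIMSEQ_inverse_real_of_nat, of t] by (simp add: inverse_eq_divide)
qed simp

text \<open>Scaling turns the lower bound into \<open>(1 - \<tau>/K)^K \<le> \<psi> \<tau>\<close>,
  hence \<open>exp (-\<tau>) \<le> \<psi> \<tau>\<close>. So \<open>g = - ln \<psi>\<close> is
  defined, lies between 0 and \<open>\<tau>\<close>, is continuous, and satisfies
  \<open>g \<tau> = K g(\<tau>/K)\<close>; such a function is linear, and \<open>\<theta>\<close> is
  its slope \<open>g 1\<close>.\<close>

lemma power_scaling_imp_exp:
  fixes \<psi> :: "real \<Rightarrow> real" and d :: nat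
  assumes d: "0 < d"
    and scale: "\<And>m \<tau>. 1 \<le> m \<Longrightarrow> 0 \<le> \<tau> \<Longrightarrow> \<psi> \<tau> = \<psi> (\<tau> / real (m ^ d)) ^ (m ^ d)"
    and lip: "\<And>\<tau> \<tau>'. 0 \<le> \<tau> \<Longrightarrow> 0 \<le> \<tau>' \<Longrightarrow> \<bar>\<psi> \<tau> - \<psi> \<tau>'\<bar> \<le> \<bar>\<tau> - \<tau>'\<bar>"
    and lower: "\<And>\<tau>. 0 \<le> \<tau> \<Longrightarrow> 1 - \<tau> \<le> \<psi> \<tau>"
    and upper: "\<And>\<tau>. 0 \<le> \<tau> \<Longrightarrow> \<psi> \<tau> \<le> 1"
  shows "\<exists>\<theta>. 0 \<le> \<theta> \<and> \<theta> \<le> 1 \<and> (\<forall>\<tau>\<ge>0. \<psi> \<tau> = exp (- \<theta> * \<tau>))"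
proof -
  have ge: "exp (- \<tau>) \<le> \<psi> \<tau>" if \<tau>: "0 \<le> \<tau>" for \<tau>
  proof (rule tendsto_upperbound)
    have pow: "filterlim (\<lambda>m. m ^ d) sequentially sequentially"
    proof (rule filterlim_at_top_mono[OF filterlim_ident])
      show "\<forall>\<^sub>F m in sequentially. m \<le> m ^ d"
        using eventually_ge_at_top[of 1] by eventually_elim (use d in \<open>auto intro: self_le_power\<close>)
    qed
    show "(\<lambda>m. (1 + (- \<tau>) / real (m ^ d)) ^ (m ^ d)) \<longlonglongrightarrow> exp (- \<tau>)"
      by (rule filterlim_compose[OF tendsto_exp_limit_sequentially pow])
    \<comment> \<open>For such \<open>m\<close> the base \<open>1 - \<tau> / m ^ d\<close> is
      nonnegative, without which the inequality could not be raised to a power.\<close>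
    have "\<forall>\<^sub>F m in sequentially. real (m ^ d) \<ge> max 1 \<tau>"
      using filterlim_compose[OF filterlim_real_sequentially pow] unfolding filterlim_at_top by blast
    then show "\<forall>\<^sub>F m in sequentially. (1 + (- \<tau>) / real (m ^ d)) ^ (m ^ d) \<le> \<psi> \<tau>"
      using eventually_ge_at_top[of 1]
    proof eventually_elim
      case (elim m)
      then have "0 \<le> 1 + - \<tau> / real (m ^ d)" by (simp add: field_simps)
      moreover have "1 + - \<tau> / real (m ^ d) \<le> \<psi> (\<tau> / real (m ^ d))"
        using lower[of "\<tau> / real (m ^ d)"] \<tau> by simp
      ultimately have "(1 + (- \<tau>) / real (m ^ d)) ^ (m ^ d) \<le> \<psi> (\<tau> / real (m ^ d)) ^ (m ^ d)"
        by (intro power_mono)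
      then show ?case using scale[OF elim(2) \<tau>] by simp
    qed
  qed simp
  have pos: "0 < \<psi> \<tau>" if "0 \<le> \<tau>" for \<tau>
    using ge[OF that] exp_gt_zero[of "- \<tau>"] by linarith
  define g where "g \<tau> = - ln (\<psi> \<tau>)" for \<tau>
  have g_bounds: "0 \<le> g \<tau>" "g \<tau> \<le> \<tau>" if "0 \<le> \<tau>" for \<tau>
  proof -
    show "0 \<le> g \<tau>" using upper[OF that] pos[OF that] by (simp add: g_def)
    have "ln (exp (- \<tau>)) \<le> ln (\<psi> \<tau>)" using ge[OF that] by (intro ln_mono) auto
    then show "g \<tau> \<le> \<tau>" by (simp add: g_def)
  qed
  have g_scale: "g \<tau> = real (m ^ d) * g (\<tau> / real (m ^ d))" if "1 \<le> m" "0 \<le> \<tau>" for m \<tau>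
    using pos[of "\<tau> / real (m ^ d)"] that by (simp add: g_def scale[OF that] ln_realpow)
  have "continuous_on {0..} \<psi>"
    unfolding continuous_on_iff
  proof (intro ballI allI impI)
    fix x e :: real assume "x \<in> {0..}" "0 < e"
    then show "\<exists>d>0. \<forall>y\<in>{0..}. dist y x < d \<longrightarrow> dist (\<psi> y) (\<psi> x) < e"
      using lip by (intro exI[of _ e]) (auto simp: dist_real_def intro: le_less_trans)
  qed
  then have g_cont: "continuous_on {0..} g"
    unfolding g_def using pos by (intro continuous_intros) (auto simp: less_imp_neq[symmetric] order.strict_iff_not)
  \<comment> \<open>The scaling relation fixes \<open>g\<close> on \<open>d\<close>-th powers of rationals, which are dense.\<close>
  have rational: "g ((real p / real q) ^ d) = (real p / real q) ^ d * g 1" if "1 \<le> q" for p q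
  proof (cases "p = 0")
    case True
    then show ?thesis using g_bounds[of 0] d by (simp add: power_0_left)
  next
    case False
    \<comment> \<open>Scaling the same argument \<open>p ^ d\<close> once by \<open>p\<close> and
      once by \<open>q\<close> links \<open>g 1\<close> with the value at
      \<open>(p / q) ^ d\<close>.\<close>
    have "g (real (p ^ d)) = real (p ^ d) * g 1"
      using g_scale[of p "real (p ^ d)"] False by simp
    moreover have "g (real (p ^ d)) = real (q ^ d) * g (real (p ^ d) / real (q ^ d))"
      using g_scale[of q "real (p ^ d)"] that by simp
    ultimately show ?thesis using that by (simp add: power_divide field_simps)
  qed
  have linear: "g \<tau> = \<tau> * g 1" if \<tau>: "0 \<le> \<tau>" for \<tau>
  proof -
    \<comment> \<open>Approximating the root instead of \<open>\<tau>\<close> itself makes the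
      approximants of \<open>\<tau>\<close> exact \<open>d\<close>-th powers of rationals.\<close>
    define t where "t = root d \<tau>"
    have t: "0 \<le> t" "t ^ d = \<tau>" using \<tau> d by (auto simp: t_def)
    let ?x = "\<lambda>k. real (nat \<lfloor>t * real (Suc k)\<rfloor>) / real (Suc k)"
    have x: "(\<lambda>k. ?x k ^ d) \<longlonglongrightarrow> \<tau>"
      using tendsto_power[OF LIMSEQ_floor_div[OF t(1)], of d] t(2) by simp
    have "(\<lambda>k. g (?x k ^ d)) \<longlonglongrightarrow> g \<tau>"
      by (rule continuous_on_tendsto_compose[OF g_cont x]) (use \<tau> in auto)
    moreover have "g (?x k ^ d) = ?x k ^ d * g 1" for k by (rule rational) simp
    ultimately have "(\<lambda>k. ?x k ^ d * g 1) \<longlonglongrightarrow> g \<tau>" by (simp only:)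
    then show ?thesis by (rule LIMSEQ_unique) (intro tendsto_mult x tendsto_const)
  qed
  have "\<psi> \<tau> = exp (- g 1 * \<tau>)" if "0 \<le> \<tau>" for \<tau>
    using linear[OF that] pos[OF that] by (simp add: g_def exp_minus mult.commute) (metis exp_ln minus_minus)
  then show ?thesis using g_bounds[of 1] by (intro exI[of _ "g 1"]) auto
qed

text \<open>\<open>\<Phi>\<close> stands for \<^const>\<open>Limsup\<close> or \<^const>\<open>Liminf\<close> along \<^const>\<open>at_top\<close>; the three assumptions on it
  hold for both.\<close>

lemma scaled_limit_functional:
  fixes F :: "real \<Rightarrow> real \<Rightarrow> real" and d :: nat and \<Phi> :: "(real \<Rightarrow> ereal) \<Rightarrow> ereal"
  assumes mono: "\<And>g h. \<forall>\<^sub>F \<rho> in at_top. g \<rho> \<le> h \<rho> \<Longrightarrow> \<Phi> g \<le> \<Phi> h"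
    and reparam: "\<And>g K. 0 < K \<Longrightarrow> \<Phi> (\<lambda>\<rho>. g (\<rho> / K)) = \<Phi> g"
    and comp: "\<And>f g. continuous_on UNIV f \<Longrightarrow> mono f \<Longrightarrow> \<Phi> (\<lambda>\<rho>. f (g \<rho>)) = f (\<Phi> g)"
    and d: "0 < d"
    and range: "\<And>\<rho> \<tau>. 0 \<le> F \<rho> \<tau>" "\<And>\<rho> \<tau>. F \<rho> \<tau> \<le> 1"
    and scale: "\<And>m \<tau>. 1 \<le> m \<Longrightarrow> 0 \<le> \<tau> \<Longrightarrow>
      ((\<lambda>\<rho>. F \<rho> \<tau> - F (\<rho> / real (m ^ d)) (\<tau> / real (m ^ d)) ^ (m ^ d)) \<longlongrightarrow> 0) at_top"
    and lip: "\<And>\<tau> \<tau>'. 0 \<le> \<tau> \<Longrightarrow> 0 \<le> \<tau>' \<Longrightarrow>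
      \<exists>h. (h \<longlongrightarrow> \<bar>\<tau> - \<tau>'\<bar>) at_top \<and> (\<forall>\<^sub>F \<rho> in at_top. \<bar>F \<rho> \<tau> - F \<rho> \<tau>'\<bar> \<le> h \<rho>)"
    and lower: "\<And>\<tau>. 0 \<le> \<tau> \<Longrightarrow>
      \<exists>h. (h \<longlongrightarrow> \<tau>) at_top \<and> (\<forall>\<^sub>F \<rho> in at_top. 1 - F \<rho> \<tau> \<le> h \<rho>)"
  shows "\<exists>\<theta>. 0 \<le> \<theta> \<and> \<theta> \<le> 1 \<and> (\<forall>\<tau>\<ge>0. \<Phi> (\<lambda>\<rho>. ereal (F \<rho> \<tau>)) = ereal (exp (- \<theta> * \<tau>)))"
proof -
  \<comment> \<open>Continuous and monotone on all of \<^typ>\<open>ereal\<close>, so that \<open>comp\<close> applies to real functions on \<open>[0, 1]\<close>.\<close>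
  define clamp where "clamp x = real_of_ereal (max 0 (min 1 x))" for x
  have fin: "\<bar>max 0 (min 1 x) :: ereal\<bar> \<noteq> \<infinity>" for x by (cases x) (auto simp: max_def min_def)
  have clamp_range: "clamp x \<in> {0..1}" for x
    by (cases x) (auto simp: clamp_def max_def min_def)
  have clamp_ereal: "clamp (ereal x) = x" if "x \<in> {0..1}" for x
    using that by (auto simp: clamp_def max_def min_def)
  have clamp_cont: "continuous_on UNIV clamp"
  proof -
    have "continuous_on UNIV (\<lambda>x :: ereal. max 0 (min 1 x))" by (intro continuous_intros)
    then show ?thesis using fin
      by (subst (asm) continuous_on_iff_real) (auto simp: clamp_def[abs_def] comp_def)
  qed
  have clamp_mono: "x \<le> y \<Longrightarrow> clamp x \<le> clamp y" for x y
    unfolding clamp_def using fin[of x] fin[of y]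
    by (intro real_of_ereal_positive_mono) (auto simp: max_def min_def)
  define L where "L g = clamp (\<Phi> (\<lambda>\<rho>. ereal (g \<rho>)))" for g
  have L_comp: "\<Phi> (\<lambda>\<rho>. ereal (\<phi> (g \<rho>))) = ereal (\<phi> (L g))"
    if "continuous_on {0..1} \<phi>" "mono_on {0..1} \<phi>" "\<And>\<rho>. g \<rho> \<in> {0..1}" for \<phi> g
  proof -
    let ?f = "\<lambda>x. ereal (\<phi> (clamp x))"
    have "continuous_on UNIV ?f"
      using clamp_range
      by (intro continuous_on_ereal continuous_on_compose2[OF that(1) clamp_cont]) auto
    moreover have "mono ?f"
      using that(2) clamp_mono clamp_range by (intro monoI) (auto simp: mono_on_def)
    ultimately have "\<Phi> (\<lambda>\<rho>. ?f (ereal (g \<rho>))) = ?f (\<Phi> (\<lambda>\<rho>. ereal (g \<rho>)))" by (rule comp)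
    then show ?thesis using that(3) by (simp add: clamp_ereal L_def)
  qed
  \<comment> \<open>Taking the identity for \<open>\<phi>\<close> shows that \<open>\<Phi>\<close>
    itself takes a real value in \<open>[0, 1]\<close>, so the clamping in \<open>L\<close> loses
    nothing.\<close>
  have L: "\<Phi> (\<lambda>\<rho>. ereal (g \<rho>)) = ereal (L g)" if "\<And>\<rho>. g \<rho> \<in> {0..1}" for g
    using L_comp[of "\<lambda>x. x" g] that by (auto simp: mono_on_def)
  have L_range: "L g \<in> {0..1}" for g unfolding L_def by (rule clamp_range)
  have le: "L g \<le> L h + c"
    if gh: "\<And>\<rho>. g \<rho> \<in> {0..1}" "\<And>\<rho>. h \<rho> \<in> {0..1}" and k: "(k \<longlongrightarrow> c) at_top"
      "\<forall>\<^sub>F \<rho> in at_top. g \<rho> - h \<rho> \<le> k \<rho>" for g h k c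
  proof (rule field_le_epsilon)
    fix e :: real assume "0 < e"
    then have "\<forall>\<^sub>F \<rho> in at_top. k \<rho> < c + e" using k(1) by (intro order_tendstoD) auto
    with k(2) have "\<forall>\<^sub>F \<rho> in at_top. ereal (g \<rho>) \<le> ereal (h \<rho> + (c + e))"
      by eventually_elim auto
    then have "\<Phi> (\<lambda>\<rho>. ereal (g \<rho>)) \<le> \<Phi> (\<lambda>\<rho>. ereal (h \<rho> + (c + e)))" by (rule mono)
    also have "\<dots> = ereal (L h + (c + e))"
      by (rule L_comp[of "\<lambda>x. x + (c + e)"]) (use gh in \<open>auto simp: mono_on_def intro!: continuous_intros\<close>)
    finally show "L g \<le> L h + c + e" using L[OF gh(1)] by simp
  qed
  have abs_le: "\<bar>L g - L h\<bar> \<le> c"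
    if gh: "\<And>\<rho>. g \<rho> \<in> {0..1}" "\<And>\<rho>. h \<rho> \<in> {0..1}" and k: "(k \<longlongrightarrow> c) at_top"
      "\<forall>\<^sub>F \<rho> in at_top. \<bar>g \<rho> - h \<rho>\<bar> \<le> k \<rho>" for g h k c
  proof -
    have "\<forall>\<^sub>F \<rho> in at_top. g \<rho> - h \<rho> \<le> k \<rho>" "\<forall>\<^sub>F \<rho> in at_top. h \<rho> - g \<rho> \<le> k \<rho>"
      using k(2) by (eventually_elim, auto)+
    then show ?thesis using le[of g h k c] le[of h g k c] gh k(1) by auto
  qed
  define \<psi> where "\<psi> \<tau> = L (\<lambda>\<rho>. F \<rho> \<tau>)" for \<tau>
  have range': "F \<rho> \<tau> \<in> {0..1}" for \<rho> \<tau> using range by auto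
  have "\<exists>\<theta>. 0 \<le> \<theta> \<and> \<theta> \<le> 1 \<and> (\<forall>\<tau>\<ge>0. \<psi> \<tau> = exp (- \<theta> * \<tau>))"
  proof (rule power_scaling_imp_exp[OF d])
    fix m :: nat and \<tau> :: real assume m: "1 \<le> m" and \<tau>: "0 \<le> \<tau>"
    let ?K = "m ^ d"
    let ?h = "\<lambda>\<rho>. F (\<rho> / real ?K) (\<tau> / real ?K)"
    have h: "?h \<rho> ^ ?K \<in> {0..1}" for \<rho>
      using range by (simp add: power_le_one)
    have "\<bar>L (\<lambda>\<rho>. F \<rho> \<tau>) - L (\<lambda>\<rho>. ?h \<rho> ^ ?K)\<bar> \<le> 0"
      by (rule abs_le[OF range' h tendsto_rabs_zero[OF scale[OF m \<tau>]]]) simp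
    moreover have "ereal (L (\<lambda>\<rho>. ?h \<rho> ^ ?K)) = ereal (L ?h ^ ?K)"
    proof -
      have "continuous_on {0..1} (\<lambda>x :: real. x ^ ?K)" by (intro continuous_intros)
      moreover have "mono_on {0..1} (\<lambda>x :: real. x ^ ?K)" by (auto simp: mono_on_def intro: power_mono)
      ultimately have "\<Phi> (\<lambda>\<rho>. ereal (?h \<rho> ^ ?K)) = ereal (L ?h ^ ?K)"
        by (rule L_comp) (rule range')
      then show ?thesis using L[OF h] by simp
    qed
    moreover have "L ?h = \<psi> (\<tau> / real ?K)"
      using reparam[of "real ?K" "\<lambda>\<rho>. ereal (F \<rho> (\<tau> / real ?K))"] m by (simp add: L_def \<psi>_def)
    ultimately show "\<psi> \<tau> = \<psi> (\<tau> / real ?K) ^ ?K" by (simp add: \<psi>_def)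
  next
    fix \<tau> \<tau>' :: real assume "0 \<le> \<tau>" "0 \<le> \<tau>'"
    then obtain h where "(h \<longlongrightarrow> \<bar>\<tau> - \<tau>'\<bar>) at_top" "\<forall>\<^sub>F \<rho> in at_top. \<bar>F \<rho> \<tau> - F \<rho> \<tau>'\<bar> \<le> h \<rho>"
      using lip by blast
    then show "\<bar>\<psi> \<tau> - \<psi> \<tau>'\<bar> \<le> \<bar>\<tau> - \<tau>'\<bar>"
      unfolding \<psi>_def using range' by (intro abs_le) auto
  next
    fix \<tau> :: real assume "0 \<le> \<tau>"
    then obtain h where h: "(h \<longlongrightarrow> \<tau>) at_top" "\<forall>\<^sub>F \<rho> in at_top. 1 - F \<rho> \<tau> \<le> h \<rho>"
      using lower by blast
    have "L (\<lambda>_. 1) \<le> \<psi> \<tau> + \<tau>"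
      unfolding \<psi>_def using range' h by (intro le) auto
    moreover have "ereal (L (\<lambda>_. 1)) = ereal 1"
      using comp[of "\<lambda>_. ereal 1" "\<lambda>_. ereal 1"] L[of "\<lambda>_. 1"] by (simp add: mono_def)
    ultimately show "1 - \<tau> \<le> \<psi> \<tau>" by simp
  next
    show "\<psi> \<tau> \<le> 1" for \<tau> using L_range by (simp add: \<psi>_def)
  qed
  then show ?thesis using L[OF range'] by (simp add: \<psi>_def)
qed

lemma filtermap_divide_pos_at_top:
  fixes K :: real
  assumes "0 < K"
  shows "filtermap (\<lambda>\<rho>. \<rho> / K) at_top = at_top"
proof (rule filtermap_fun_inverse[of "\<lambda>\<rho>. K * \<rho>"])
  show "filterlim (\<lambda>\<rho>. K * \<rho>) at_top at_top"
    by (rule filterlim_tendsto_pos_mult_at_top[OF tendsto_const assms filterlim_ident])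
  show "filterlim (\<lambda>\<rho>. \<rho> / K) at_top at_top"
    using filterlim_tendsto_pos_mult_at_top[OF tendsto_const _ filterlim_ident, of "1 / K"] assms by simp
  show "\<forall>\<^sub>F \<rho> in at_top. K * \<rho> / K = \<rho>" using assms by simp
qed

text \<open>Both extremal limits satisfy the scaled functional equation, each with its own exponent.
  The order of the exponents is read off at \<open>\<tau> = 1\<close>, and convergence at a single
  positive \<open>\<tau>\<close> already identifies them, since there the exponential determines its
  exponent.\<close>

lemma extremal_exponents:
  fixes F :: "real \<Rightarrow> real \<Rightarrow> real" and d :: nat
  assumes d: "0 < d"
    and range: "\<And>\<rho> \<tau>. 0 \<le> F \<rho> \<tau>" "\<And>\<rho> \<tau>. F \<rho> \<tau> \<le> 1"
    and scale: "\<And>m \<tau>. 1 \<le> m \<Longrightarrow> 0 \<le> \<tau> \<Longrightarrow>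
      ((\<lambda>\<rho>. F \<rho> \<tau> - F (\<rho> / real (m ^ d)) (\<tau> / real (m ^ d)) ^ (m ^ d)) \<longlongrightarrow> 0) at_top"
    and lip: "\<And>\<tau> \<tau>'. 0 \<le> \<tau> \<Longrightarrow> 0 \<le> \<tau>' \<Longrightarrow>
      \<exists>h. (h \<longlongrightarrow> \<bar>\<tau> - \<tau>'\<bar>) at_top \<and> (\<forall>\<^sub>F \<rho> in at_top. \<bar>F \<rho> \<tau> - F \<rho> \<tau>'\<bar> \<le> h \<rho>)"
    and lower: "\<And>\<tau>. 0 \<le> \<tau> \<Longrightarrow>
      \<exists>h. (h \<longlongrightarrow> \<tau>) at_top \<and> (\<forall>\<^sub>F \<rho> in at_top. 1 - F \<rho> \<tau> \<le> h \<rho>)"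
  shows "\<exists>\<theta> \<theta>'. 0 \<le> \<theta> \<and> \<theta> \<le> \<theta>' \<and> \<theta>' \<le> 1 \<and>
    (\<forall>\<tau>\<ge>0. Limsup at_top (\<lambda>\<rho>. ereal (F \<rho> \<tau>)) = ereal (exp (- \<theta> * \<tau>)) \<and>
            Liminf at_top (\<lambda>\<rho>. ereal (F \<rho> \<tau>)) = ereal (exp (- \<theta>' * \<tau>))) \<and>
    ((\<exists>\<tau>>0. \<exists>L. ((\<lambda>\<rho>. F \<rho> \<tau>) \<longlongrightarrow> L) at_top) \<longrightarrow>
      \<theta> = \<theta>' \<and> (\<forall>\<tau>\<ge>0. ((\<lambda>\<rho>. F \<rho> \<tau>) \<longlongrightarrow> exp (- \<theta> * \<tau>)) at_top))"
proof -
  have inj: "inj (\<lambda>\<rho>::real. \<rho> / K)" if "0 < K" for K using that by (auto simp: inj_def)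
  have "\<exists>\<theta>. 0 \<le> \<theta> \<and> \<theta> \<le> 1 \<and>
    (\<forall>\<tau>\<ge>0. Limsup at_top (\<lambda>\<rho>. ereal (F \<rho> \<tau>)) = ereal (exp (- \<theta> * \<tau>)))"
    by (rule scaled_limit_functional[OF Limsup_mono _ _ d range scale lip lower])
      (auto simp: Limsup_filtermap_eq[OF inj, symmetric] filtermap_divide_pos_at_top
        intro: Limsup_compose_continuous_mono)
  then obtain \<theta> where \<theta>: "0 \<le> \<theta>" "\<theta> \<le> 1"
    "\<And>\<tau>. 0 \<le> \<tau> \<Longrightarrow> Limsup at_top (\<lambda>\<rho>. ereal (F \<rho> \<tau>)) = ereal (exp (- \<theta> * \<tau>))" by blast
  have "\<exists>\<theta>'. 0 \<le> \<theta>' \<and> \<theta>' \<le> 1 \<and>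
    (\<forall>\<tau>\<ge>0. Liminf at_top (\<lambda>\<rho>. ereal (F \<rho> \<tau>)) = ereal (exp (- \<theta>' * \<tau>)))"
    by (rule scaled_limit_functional[OF Liminf_mono _ _ d range scale lip lower])
      (auto simp: Liminf_filtermap_eq[OF inj, symmetric] filtermap_divide_pos_at_top
        intro: Liminf_compose_continuous_mono)
  then obtain \<theta>' where \<theta>': "0 \<le> \<theta>'" "\<theta>' \<le> 1"
    "\<And>\<tau>. 0 \<le> \<tau> \<Longrightarrow> Liminf at_top (\<lambda>\<rho>. ereal (F \<rho> \<tau>)) = ereal (exp (- \<theta>' * \<tau>))" by blast
  have "ereal (exp (- \<theta>')) \<le> ereal (exp (- \<theta>))"
    using Liminf_le_Limsup[of at_top "\<lambda>\<rho>. ereal (F \<rho> 1)"] \<theta>(3)[of 1] \<theta>'(3)[of 1] by simp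
  then have le: "\<theta> \<le> \<theta>'" by simp
  \<comment> \<open>Strict positivity of \<open>\<tau>\<close> matters: at 0 both limits equal 1
    whatever the exponents are.\<close>
  have eq: "\<theta> = \<theta>'" if "0 < \<tau>" "((\<lambda>\<rho>. F \<rho> \<tau>) \<longlongrightarrow> L) at_top" for \<tau> L
  proof -
    have "((\<lambda>\<rho>. ereal (F \<rho> \<tau>)) \<longlongrightarrow> ereal L) at_top" using that(2) by simp
    then have "Liminf at_top (\<lambda>\<rho>. ereal (F \<rho> \<tau>)) = Limsup at_top (\<lambda>\<rho>. ereal (F \<rho> \<tau>))"
      by (metis lim_imp_Liminf lim_imp_Limsup trivial_limit_at_top_linorder)
    then show ?thesis using that(1) \<theta>(3)[of \<tau>] \<theta>'(3)[of \<tau>] by simp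
  qed
  have conv: "((\<lambda>\<rho>. F \<rho> \<tau>) \<longlongrightarrow> exp (- \<theta> * \<tau>)) at_top" if "\<theta> = \<theta>'" "0 \<le> \<tau>" for \<tau>
  proof -
    have "((\<lambda>\<rho>. ereal (F \<rho> \<tau>)) \<longlongrightarrow> ereal (exp (- \<theta> * \<tau>))) at_top"
      using \<theta>(3)[OF that(2)] \<theta>'(3)[OF that(2)] that(1) by (intro Liminf_eq_Limsup) auto
    then show ?thesis by simp
  qed
  show ?thesis
  proof (rule exI[of _ \<theta>], rule exI[of _ \<theta>'], intro conjI allI impI)
    assume "\<exists>\<tau>>0. \<exists>L. ((\<lambda>\<rho>. F \<rho> \<tau>) \<longlongrightarrow> L) at_top"
    then show "\<theta> = \<theta>'" using eq by blast
    then show "((\<lambda>\<rho>. F \<rho> \<tau>) \<longlongrightarrow> exp (- \<theta> * \<tau>)) at_top" if "0 \<le> \<tau>" for \<tau>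
      using conv that by blast
  qed (use \<theta> \<theta>' le in simp_all)
qed

section \<open>Blocks of the unit cube\<close>

text \<open>For positive \<open>\<rho>\<close> the scaling factor is invertible; in the preimage
  form measurability and membership are immediate.\<close>

lemma dilate_eq_vimage:
  fixes S :: "(real ^ 'n) set"
  assumes "0 < \<rho>"
  shows "dilate \<rho> S = (\<lambda>x. (1 / \<rho> powr (1 / real CARD('n))) *\<^sub>R x) -` S"
proof -
  let ?c = "\<rho> powr (1 / real CARD('n))"
  have c: "?c > 0" using assms by simp
  show ?thesis
  proof (intro equalityI subsetI)
    fix x assume "x \<in> (\<lambda>x. (1 / ?c) *\<^sub>R x) -` S"
    then show "x \<in> dilate \<rho> S"
      unfolding dilate_def using c by (intro image_eqI[of _ _ "(1 / ?c) *\<^sub>R x"]) auto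
  qed (use c in \<open>auto simp: dilate_def\<close>)
qed

lemma powr_inverse_card_power:
  assumes "0 < \<rho>"
  shows "(\<rho> powr (1 / real CARD('n::finite))) ^ CARD('n) = \<rho>"
  using assms by (simp add: powr_realpow[symmetric] powr_powr)

lemma borel_dilate [measurable]:
  fixes S :: "(real ^ 'n) set"
  assumes "0 < \<rho>" "S \<in> sets borel"
  shows "dilate \<rho> S \<in> sets borel"
proof -
  have "(\<lambda>x :: real ^ 'n. (1 / \<rho> powr (1 / real CARD('n))) *\<^sub>R x) \<in> borel_measurable borel"
    by (intro borel_measurable_continuous_onI continuous_intros)
  from measurable_sets[OF this assms(2)] show ?thesis
    by (simp add: dilate_eq_vimage[OF assms(1)])
qed

text \<open>Lengths scale by the \<open>d\<close>-th root of \<open>\<rho>\<close>, so the linear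
  change of variables multiplies volumes by \<open>\<rho>\<close> itself.\<close>

lemma emeasure_dilate:
  fixes S :: "(real ^ 'n) set"
  assumes \<rho>: "0 < \<rho>" and S: "S \<in> sets borel"
  shows "emeasure lborel (dilate \<rho> S) = ennreal \<rho> * emeasure lborel S"
proof -
  let ?c = "\<rho> powr (1 / real CARD('n))"
  have c: "?c \<noteq> 0" using \<rho> by simp
  have "emeasure lborel (dilate \<rho> S) =
    emeasure (density (distr lborel borel (\<lambda>x. 0 + ?c *\<^sub>R x)) (\<lambda>_. ennreal (\<bar>?c\<bar> ^ DIM(real ^ 'n)))) (dilate \<rho> S)"
    using lborel_affine[OF c, of "0 :: real ^ 'n"] by simp
  also have "\<dots> = ennreal (?c ^ CARD('n)) * emeasure (distr lborel borel (\<lambda>x. ?c *\<^sub>R x)) (dilate \<rho> S)"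
    using borel_dilate[OF \<rho> S] \<rho> by (simp add: emeasure_density nn_integral_cmult_indicator)
  also have "emeasure (distr lborel borel (\<lambda>x. ?c *\<^sub>R x)) (dilate \<rho> S) =
      emeasure lborel ((\<lambda>x. ?c *\<^sub>R x) -` dilate \<rho> S)"
    using borel_dilate[OF \<rho> S] by (subst emeasure_distr) auto
  also have "(\<lambda>x. ?c *\<^sub>R x) -` dilate \<rho> S = S"
    using c by (auto simp: dilate_eq_vimage[OF \<rho>])
  finally show ?thesis using powr_inverse_card_power[OF \<rho>, where 'n='n] by simp
qed

lemma borel_subcube [measurable]: "subcube a s n i \<in> sets borel"
proof -
  have "subcube a s n i = (\<Inter>r. {x. a $ r + s * real (i r) / real n \<le> x $ r} \<inter>
    ({x. x $ r < a $ r + s * real (i r + 1) / real n} \<union> {x. i r + 1 = n \<and> x $ r = a $ r + s}))"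
    by (auto simp: subcube_def)
  also have "\<dots> \<in> sets borel"
  proof (intro sets.finite_INT sets.Int sets.Un)
    fix r
    show "{x. a $ r + s * real (i r) / real n \<le> x $ r} \<in> sets borel"
      by (intro borel_closed closed_Collect_le continuous_intros)
    show "{x. x $ r < a $ r + s * real (i r + 1) / real n} \<in> sets borel"
      by (intro borel_open open_Collect_less continuous_intros)
    show "{x. i r + 1 = n \<and> x $ r = a $ r + s} \<in> sets borel"
      by (intro borel_closed closed_Collect_conj closed_Collect_eq closed_Collect_const continuous_intros)
  qed auto
  finally show ?thesis .
qed

lemma finite_grid [simp]: "finite (grid m :: ('n::finite \<Rightarrow> nat) set)"
proof -
  have "(grid m :: ('n \<Rightarrow> nat) set) = PiE UNIV (\<lambda>_. {..<m})"
    by (auto simp: grid_def PiE_def)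
  then show ?thesis by (simp add: finite_PiE)
qed

section \<open>Shrunken blocks and the volume of the gap between them\<close>

text \<open>Coordinates are those of the unit cube before dilation, and \<open>\<epsilon>\<close> is
  the margin cut off at every face. With \<open>\<epsilon> = 0\<close> these are the full closed
  blocks, which share faces.\<close>

definition block :: "nat \<Rightarrow> real \<Rightarrow> ('n::finite \<Rightarrow> nat) \<Rightarrow> (real ^ 'n) set" where
  "block m \<epsilon> j = cbox (\<chi> r. real (j r) / real m + \<epsilon>) (\<chi> r. real (j r + 1) / real m - \<epsilon>)"

lemma mem_block:
  "x \<in> block m \<epsilon> j \<longleftrightarrow>
    (\<forall>r. real (j r) / real m + \<epsilon> \<le> x $ r \<and> x $ r \<le> real (j r + 1) / real m - \<epsilon>)"
  by (simp add: block_def mem_box_cart)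

lemma block_subset_unit_cube:
  assumes "j \<in> grid m" "0 \<le> \<epsilon>"
  shows "block m \<epsilon> j \<subseteq> cbox 0 1"
proof
  fix x assume x: "x \<in> block m \<epsilon> j"
  have "0 \<le> x $ r \<and> x $ r \<le> 1" for r
  proof -
    have "j r < m" using assms(1) by (simp add: grid_def)
    then have "real (j r + 1) / real m \<le> 1" by simp
    moreover have "0 \<le> real (j r) / real m" by simp
    moreover have "real (j r) / real m + \<epsilon> \<le> x $ r" "x $ r \<le> real (j r + 1) / real m - \<epsilon>"
      using x by (auto simp: mem_block)
    ultimately show ?thesis using assms(2) by linarith
  qed
  then show "x \<in> cbox 0 1" by (simp add: mem_box_cart)
qed

text \<open>In a coordinate where the indices differ, the margins of the two blocks add up.\<close>

lemma blocks_separated: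
  assumes "x \<in> block m \<epsilon> j" "y \<in> block m \<epsilon> k" "j \<noteq> k" "0 < m"
  shows "\<exists>r. 2 * \<epsilon> \<le> \<bar>x $ r - y $ r\<bar>"
proof -
  obtain r where "j r \<noteq> k r" using assms(3) by auto
  then consider "j r + 1 \<le> k r" | "k r + 1 \<le> j r" by linarith
  then show ?thesis
  proof cases
    case 1
    then have "real (j r + 1) / real m \<le> real (k r) / real m" by (intro divide_right_mono) auto
    moreover have "x $ r \<le> real (j r + 1) / real m - \<epsilon>" "real (k r) / real m + \<epsilon> \<le> y $ r"
      using assms(1,2) by (auto simp: mem_block)
    ultimately have "2 * \<epsilon> \<le> \<bar>x $ r - y $ r\<bar>" by linarith
    then show ?thesis ..
  next
    case 2
    then have "real (k r + 1) / real m \<le> real (j r) / real m" by (intro divide_right_mono) auto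
    moreover have "y $ r \<le> real (k r + 1) / real m - \<epsilon>" "real (j r) / real m + \<epsilon> \<le> x $ r"
      using assms(1,2) by (auto simp: mem_block)
    ultimately have "2 * \<epsilon> \<le> \<bar>x $ r - y $ r\<bar>" by linarith
    then show ?thesis ..
  qed
qed

text \<open>Since \<open>\<rho> powr (1/d) / m\<close> is the \<open>d\<close>-th root of
  \<open>\<rho> / m ^ d\<close>, a full block of the window for \<open>\<rho>\<close> is a translate
  of the window for \<open>\<rho> / m ^ d\<close>. This is the origin of the scaling equation and of
  its restriction to factors \<open>m ^ d\<close>.\<close>

lemma dilate_block_0:
  assumes "0 < \<rho>" "0 < m"
  shows "dilate \<rho> (block m 0 j) =
    (+) (\<chi> r. \<rho> powr (1 / real CARD('n)) * real (j r) / real m) `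
      dilate (\<rho> / real (m ^ CARD('n))) (cbox 0 (1 :: real ^ 'n))"
proof -
  let ?c = "\<rho> powr (1 / real CARD('n))"
  let ?b = "\<chi> r. ?c * real (j r) / real m"
  let ?W = "dilate (\<rho> / real (m ^ CARD('n))) (cbox 0 (1 :: real ^ 'n))"
  have c: "?c > 0" using assms by simp
  have root: "(\<rho> / real (m ^ CARD('n))) powr (1 / real CARD('n)) = ?c / real m"
    using assms by (simp add: powr_divide powr_realpow[symmetric] powr_powr)
  have "0 < \<rho> / real (m ^ CARD('n))" using assms by simp
  note W = dilate_eq_vimage[OF this, of "cbox 0 (1 :: real ^ 'n)", unfolded root]
  have mem_W: "y \<in> ?W \<longleftrightarrow> (\<forall>r. 0 \<le> real m * y $ r / ?c \<and> real m * y $ r / ?c \<le> 1)" for y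
    unfolding W by (simp add: mem_box_cart)
  have "x \<in> dilate \<rho> (block m 0 j) \<longleftrightarrow> x - ?b \<in> ?W" for x
  proof -
    have shift: "real m * (x - ?b) $ r / ?c = real m * (x $ r / ?c) - real (j r)" for r
      using assms(2) c by (simp add: field_simps)
    have "real (j r) / real m \<le> x $ r / ?c \<longleftrightarrow> 0 \<le> real m * (x - ?b) $ r / ?c"
      "x $ r / ?c \<le> real (j r + 1) / real m \<longleftrightarrow> real m * (x - ?b) $ r / ?c \<le> 1" for r
      unfolding shift using assms(2)
      by (simp_all add: pos_divide_le_eq pos_le_divide_eq algebra_simps)
    then show ?thesis
      unfolding mem_W by (simp add: dilate_eq_vimage[OF assms(1)] mem_block)
  qed
  moreover have "x - ?b \<in> ?W \<longleftrightarrow> x \<in> (+) ?b ` ?W" for x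
    by (auto intro!: image_eqI[of _ _ "x - ?b"])
  ultimately show ?thesis by blast
qed

definition block_gap :: "nat \<Rightarrow> real \<Rightarrow> (real ^ 'n::finite) set" where
  "block_gap m \<epsilon> = cbox 0 1 - (\<Union>j\<in>grid m. block m \<epsilon> j)"

lemma borel_block_gap [measurable]: "(block_gap m \<epsilon> :: (real ^ 'n::finite) set) \<in> sets borel"
proof -
  have "(\<Union>j\<in>(grid m :: ('n \<Rightarrow> nat) set). block m \<epsilon> j) \<in> sets borel"
    by (rule sets.finite_UN) (auto simp: block_def)
  then show ?thesis unfolding block_gap_def by auto
qed

text \<open>The \<open>m ^ d\<close> shrunken blocks have side \<open>1/m - 2 \<epsilon>\<close>,
  which is positive by the second bound on \<open>\<epsilon>\<close>, and are disjoint because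
  \<open>\<epsilon> > 0\<close>; together they fill the volume
  \<open>(1 - 2 \<epsilon> m) ^ d\<close>.\<close>

lemma emeasure_block_gap:
  assumes m: "0 < m" and \<epsilon>: "0 < \<epsilon>" "2 * \<epsilon> * real m < 1"
  shows "emeasure lborel (block_gap m \<epsilon> :: (real ^ 'n) set) = ennreal (1 - (1 - 2 * \<epsilon> * real m) ^ CARD('n))"
proof -
  let ?G = "grid m :: ('n \<Rightarrow> nat) set"
  have side: "0 < 1 / real m - 2 * \<epsilon>" using m \<epsilon>(2) by (simp add: field_simps)
  have meas: "measure lborel (block m \<epsilon> j) = (1 / real m - 2 * \<epsilon>) ^ CARD('n)" for j :: "'n \<Rightarrow> nat"
  proof -
    have ne: "block m \<epsilon> j \<noteq> {}"
    proof -
      have "(\<chi> r. real (j r) / real m + \<epsilon>) \<in> block m \<epsilon> j"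
        using side by (simp add: mem_block add_divide_distrib)
      then show ?thesis by blast
    qed
    have "measure lborel (block m \<epsilon> j) = (\<Prod>r\<in>(UNIV :: 'n set). 1 / real m - 2 * \<epsilon>)"
      using content_cbox_cart[OF ne[unfolded block_def]]
      by (simp add: block_def add_divide_distrib algebra_simps)
    then show ?thesis by simp
  qed
  have disj: "disjoint_family_on (block m \<epsilon>) ?G"
    unfolding disjoint_family_on_def
  proof (intro ballI impI equals0I)
    fix j k x assume "j \<noteq> k" "x \<in> block m \<epsilon> j \<inter> block m \<epsilon> k"
    then show False using blocks_separated[of x m \<epsilon> j x k] m \<epsilon> by auto
  qed
  have UN_borel: "(\<Union>j\<in>?G. block m \<epsilon> j) \<in> sets borel"
    by (rule sets.finite_UN) (auto simp: block_def)
  have "measure lborel (\<Union>j\<in>?G. block m \<epsilon> j) = (\<Sum>j\<in>?G. measure lborel (block m \<epsilon> j))"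
  proof (intro measure_finite_Union disj)
    show "emeasure lborel (block m \<epsilon> j) \<noteq> \<infinity>" for j :: "'n \<Rightarrow> nat"
      using emeasure_lborel_cbox_finite by (simp add: block_def less_top)
  qed (auto simp: block_def)
  also have "\<dots> = (real m * (1 / real m - 2 * \<epsilon>)) ^ CARD('n)"
    by (simp add: meas card_grid power_mult_distrib)
  also have "real m * (1 / real m - 2 * \<epsilon>) = 1 - 2 * \<epsilon> * real m"
    using m by (simp add: field_simps)
  finally have UN: "measure lborel (\<Union>j\<in>?G. block m \<epsilon> j) = (1 - 2 * \<epsilon> * real m) ^ CARD('n)" .
  have fin: "emeasure lborel (cbox 0 (1 :: real ^ 'n)) < \<infinity>" by (rule emeasure_lborel_cbox_finite)
  have "measure lborel (block_gap m \<epsilon> :: (real ^ 'n) set) =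
      measure lborel (cbox 0 (1 :: real ^ 'n)) - measure lborel (\<Union>j\<in>?G. block m \<epsilon> j)"
    unfolding block_gap_def
    by (rule measure_Diff)
      (use fin UN_borel block_subset_unit_cube[OF _ less_imp_le[OF \<epsilon>(1)]] in \<open>auto simp del: Union_iff UN_iff simp: UN_subset_iff\<close>)
  also have "measure lborel (cbox 0 (1 :: real ^ 'n)) = 1"
    by (subst content_cbox_cart) (auto simp: interval_ne_empty_cart)
  finally have "measure lborel (block_gap m \<epsilon> :: (real ^ 'n) set) = 1 - (1 - 2 * \<epsilon> * real m) ^ CARD('n)"
    by (simp add: UN)
  moreover have "emeasure lborel (block_gap m \<epsilon> :: (real ^ 'n) set) < \<infinity>"
    by (rule le_less_trans[OF emeasure_mono fin]) (auto simp: block_gap_def)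
  ultimately show ?thesis by (simp add: emeasure_eq_ennreal_measure less_top)
qed

section \<open>The sub-cubes attached to a block\<close>

text \<open>Sub-cubes that merely meet the shrunken block are taken: their union covers it, and for
  a fine grid still stays inside the full block, so the maxima over these sub-cubes are caught
  between the two.\<close>

definition block_cells :: "real ^ 'n \<Rightarrow> real \<Rightarrow> nat \<Rightarrow> nat \<Rightarrow> real \<Rightarrow> ('n::finite \<Rightarrow> nat) \<Rightarrow> ('n \<Rightarrow> nat) set" where
  "block_cells a s n m \<epsilon> j = {i \<in> grid n. subcube a s n i \<inter> block m \<epsilon> j \<noteq> {}}"

lemma subcube_bounds:
  assumes "x \<in> subcube a s n i" "0 < s" "i \<in> grid n"
  shows "a $ r + s * real (i r) / real n \<le> x $ r" "x $ r \<le> a $ r + s * real (i r + 1) / real n"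
proof -
  have "0 < n" using assms(3) by (auto simp: grid_def intro: gr_implies_not0)
  then show "a $ r + s * real (i r) / real n \<le> x $ r" "x $ r \<le> a $ r + s * real (i r + 1) / real n"
    using assms by (auto simp: subcube_def intro: less_imp_le simp del: of_nat_add)
qed

text \<open>A sub-cube of side at most \<open>\<epsilon>\<close> that reaches the shrunken block
  cannot cross the margin.\<close>

lemma subcube_subset_block:
  assumes "i \<in> block_cells a s n m \<epsilon> j" "0 < s" "s / real n \<le> \<epsilon>"
  shows "subcube a s n i \<subseteq> block m 0 j"
proof
  fix y assume y: "y \<in> subcube a s n i"
  obtain x where i: "i \<in> grid n" and x: "x \<in> subcube a s n i" "x \<in> block m \<epsilon> j"
    using assms(1) by (auto simp: block_cells_def)
  have "real (j r) / real m + 0 \<le> y $ r \<and> y $ r \<le> real (j r + 1) / real m - 0" for r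
  proof -
    have "s * real (i r + 1) / real n = s * real (i r) / real n + s / real n"
      by (simp add: distrib_left add_divide_distrib)
    moreover have "real (j r) / real m + \<epsilon> \<le> x $ r" "x $ r \<le> real (j r + 1) / real m - \<epsilon>"
      using x(2) by (auto simp: mem_block)
    ultimately show ?thesis
      using subcube_bounds[OF x(1) assms(2) i, of r] subcube_bounds[OF y assms(2) i, of r] assms(3)
      by linarith
  qed
  then show "y \<in> block m 0 j" by (simp add: mem_block)
qed

lemma block_subset_subcubes:
  fixes a :: "real ^ 'n"
  assumes "cbox 0 1 \<subseteq> cube a s" "0 < s" "0 < n" "j \<in> grid m" "0 \<le> \<epsilon>"
  shows "block m \<epsilon> j \<subseteq> (\<Union>i\<in>block_cells a s n m \<epsilon> j. subcube a s n i)"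
proof
  fix x assume x: "x \<in> block m \<epsilon> j"
  then have "x \<in> cube a s" using block_subset_unit_cube[OF assms(4,5)] assms(1) by blast
  then obtain i where "i \<in> grid n" "x \<in> subcube a s n i"
    using subcubes_partition(1)[OF assms(2,3), of a] by blast
  then show "x \<in> (\<Union>i\<in>block_cells a s n m \<epsilon> j. subcube a s n i)"
    using x by (auto simp: block_cells_def)
qed

text \<open>Some coordinate separates the two shrunken blocks by \<open>2 \<epsilon>\<close>, while
  sub-cubes whose indices differ by \<open>D\<close> there contain only points at most
  \<open>s (D + 1) / n\<close> apart; hence \<open>D + 1 > R + 1\<close>. The added 1 is the width
  of a sub-cube.\<close>

lemma index_dist_block_cells:
  assumes "i \<in> block_cells a s n m \<epsilon> j" "l \<in> block_cells a s n m \<epsilon> k" "j \<noteq> k"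
    and "0 < m" "0 < s" "0 < n" "s * (real_of_int R + 1) < 2 * \<epsilon> * real n"
  shows "R < index_dist i l"
proof -
  obtain x where i: "i \<in> grid n" and x: "x \<in> subcube a s n i" "x \<in> block m \<epsilon> j"
    using assms(1) by (auto simp: block_cells_def)
  obtain y where l: "l \<in> grid n" and y: "y \<in> subcube a s n l" "y \<in> block m \<epsilon> k"
    using assms(2) by (auto simp: block_cells_def)
  obtain r where r: "2 * \<epsilon> \<le> \<bar>x $ r - y $ r\<bar>"
    using blocks_separated[OF x(2) y(2) assms(3,4)] by blast
  have "\<bar>x $ r - y $ r\<bar> \<le> s * (real_of_int \<bar>int (i r) - int (l r)\<bar> + 1) / real n"
  proof -
    have "x $ r - y $ r \<le> s * real (i r + 1) / real n - s * real (l r) / real n"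
      "y $ r - x $ r \<le> s * real (l r + 1) / real n - s * real (i r) / real n"
      using subcube_bounds[OF x(1) assms(5) i, of r] subcube_bounds[OF y(1) assms(5) l, of r] by linarith+
    moreover have "s * real (i r + 1) / real n - s * real (l r) / real n \<le>
        s * (real_of_int \<bar>int (i r) - int (l r)\<bar> + 1) / real n"
      "s * real (l r + 1) / real n - s * real (i r) / real n \<le>
        s * (real_of_int \<bar>int (i r) - int (l r)\<bar> + 1) / real n"
      unfolding diff_divide_distrib[symmetric] right_diff_distrib[symmetric]
      using assms(5) by (intro divide_right_mono mult_left_mono; simp)+
    ultimately show ?thesis by linarith
  qed
  with r have "2 * \<epsilon> \<le> s * (real_of_int \<bar>int (i r) - int (l r)\<bar> + 1) / real n" by linarith
  then have "2 * \<epsilon> * real n \<le> s * (real_of_int \<bar>int (i r) - int (l r)\<bar> + 1)"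
    using assms(6) by (simp add: pos_le_divide_eq)
  with assms(7) have "s * (real_of_int R + 1) < s * (real_of_int \<bar>int (i r) - int (l r)\<bar> + 1)" by linarith
  then have "R < \<bar>int (i r) - int (l r)\<bar>" using assms(5) by simp
  also have "\<dots> \<le> index_dist i l" unfolding index_dist_def by (rule Max_ge) auto
  finally show ?thesis .
qed

lemma index_set_dist_gt:
  assumes "finite I" "finite J" "I \<noteq> {}" "J \<noteq> {}"
    and "\<And>i j. i \<in> I \<Longrightarrow> j \<in> J \<Longrightarrow> R < index_dist i j"
  shows "R < index_set_dist I J"
proof -
  have "finite {index_dist i j |i j. i \<in> I \<and> j \<in> J}"
    using finite_image_set2[of "\<lambda>i. i \<in> I" "\<lambda>j. j \<in> J"] assms(1,2) by simp
  then show ?thesis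
    unfolding index_set_dist_def using assms(3-5) by (subst Min_gr_iff) auto
qed

section \<open>Approximate independence of the blocks\<close>

lemma le_of_generated_events:
  assumes "finite I" "I \<noteq> {}"
  shows "{\<omega> \<in> space M. \<forall>i\<in>I. Y i \<omega> \<le> v} \<in> generated_events M Y I"
proof -
  interpret sigma_algebra "space M" "generated_events M Y I"
    unfolding generated_events_def by (rule sigma_algebra_sigma_sets) auto
  have "Y i -` {..v} \<inter> space M \<in> generated_events M Y I" if "i \<in> I" for i
    unfolding generated_events_def
    by (rule sigma_sets.Basic, intro CollectI exI[of _ i] exI[of _ "{..v}"]) (simp add: that)
  then have "(\<Inter>i\<in>I. Y i -` {..v} \<inter> space M) \<in> generated_events M Y I"
    using assms by (intro finite_INT) auto
  also have "(\<Inter>i\<in>I. Y i -` {..v} \<inter> space M) = {\<omega> \<in> space M. \<forall>i\<in>I. Y i \<omega> \<le> v}"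
    using assms(2) by auto
  finally show ?thesis .
qed

text \<open>Conditioning on \<open>A\<close> can lower a probability by at most the mass of the
  complement of \<open>A\<close>; the same bound for the complementary event limits the
  increase.\<close>

lemma (in prob_space) abs_prob_uniform_measure_diff_le:
  assumes A: "A \<in> events" "0 < prob A" and E: "E \<in> events"
  shows "\<bar>measure (uniform_measure M A) E - prob E\<bar> \<le> 1 - prob A"
proof -
  have cond: "measure (uniform_measure M A) B = prob (A \<inter> B) / prob A" if "B \<in> events" for B
    using A(2) that by (subst measure_uniform_measure) (auto simp: emeasure_eq_measure)
  have lower: "prob B - (1 - prob A) \<le> measure (uniform_measure M A) B" if B: "B \<in> events" for B
  proof -
    have "prob B \<le> prob (A \<inter> B) + prob (space M - A)"
    proof -
      have "prob B \<le> prob ((A \<inter> B) \<union> (space M - A))"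
        using A B sets.sets_into_space[OF B] by (intro finite_measure_mono) auto
      also have "\<dots> \<le> prob (A \<inter> B) + prob (space M - A)"
        using A B by (intro measure_Un_le) auto
      finally show ?thesis .
    qed
    also have "prob (space M - A) = 1 - prob A" using A by (simp add: prob_compl)
    also have "prob (A \<inter> B) \<le> prob (A \<inter> B) / prob A"
      using A(2) mult_left_mono[OF prob_le_1[of A] measure_nonneg[of M "A \<inter> B"]]
      by (simp add: pos_le_divide_eq)
    finally show ?thesis using cond[OF B] by simp
  qed
  interpret U: prob_space "uniform_measure M A"
    using A(2) by (intro prob_space_uniform_measure) (auto simp: emeasure_eq_measure)
  have "U.prob (space M - E) = 1 - U.prob E"
    using U.prob_compl[of E] E by simp
  then show ?thesis
    using lower[OF E] lower[of "space M - E"] E prob_compl[OF E] by (simp add: abs_le_iff) 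
qed

context typical_cell_model
begin

text \<open>The supremum over no cells is minus infinity, so a window without nuclei lies below
  every threshold, in agreement with the complement of an exceedance.\<close>

lemma cell_max_le_eq:
  "{\<omega> \<in> space M. cell_max f z (\<mm> \<omega>) B \<le> ereal v} = space M - exceedance {v<..} B"
  by (auto simp: cell_max_def cells_in_def exceedance_def SUP_le_iff not_less)

lemma prob_cell_max_le:
  assumes "B \<in> sets borel"
  shows "\<P>(\<omega> in M. cell_max f z (\<mm> \<omega>) B \<le> ereal v) = 1 - M.prob (exceedance {v<..} B)"
  unfolding cell_max_le_eq using assms by (intro M.prob_compl exceedance_sets) auto

lemma events_cell_max_le:
  assumes "B \<in> sets borel"
  shows "{\<omega> \<in> space M. cell_max f z (\<mm> \<omega>) B \<le> ereal v} \<in> M.events"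
  unfolding cell_max_le_eq using exceedance_sets[of "{v<..}" B] assms by auto

definition tail :: "real \<Rightarrow> real" where
  "tail v = \<P>(\<omega> in N. f (X \<omega>) > v)"

lemma measurable_typical_value: "(\<lambda>\<omega>. f (X \<omega>)) \<in> borel_measurable N"
  using typical f(2) unfolding typical_cell_def by (blast intro: measurable_compose)

lemma tail_Ioc:
  assumes "v \<le> v'"
  shows "\<P>(\<omega> in N. f (X \<omega>) \<in> {v<..v'}) = tail v - tail v'"
proof -
  note [measurable] = measurable_typical_value
  have "{\<omega> \<in> space N. f (X \<omega>) \<in> {v<..v'}} =
    {\<omega> \<in> space N. f (X \<omega>) > v} - {\<omega> \<in> space N. f (X \<omega>) > v'}"
    by auto
  also have "N.prob \<dots> = tail v - tail v'"
    unfolding tail_def using assms by (intro N.finite_measure_Diff) auto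
  finally show ?thesis .
qed

text \<open>The two events differ only when some cell has its value between the thresholds, which
  the first moment bound controls. The absolute values allow either order of the thresholds, so laws
  can be compared through tails alone.\<close>

lemma prob_cell_max_diff_le:
  assumes B: "B \<in> sets borel" "0 < emeasure lborel B" "emeasure lborel B < \<infinity>"
  shows "\<bar>\<P>(\<omega> in M. cell_max f z (\<mm> \<omega>) B \<le> ereal v) - \<P>(\<omega> in M. cell_max f z (\<mm> \<omega>) B \<le> ereal v')\<bar>
    \<le> measure lborel B * \<bar>tail v - tail v'\<bar>"
proof -
  have le: "\<bar>\<P>(\<omega> in M. cell_max f z (\<mm> \<omega>) B \<le> ereal v) - \<P>(\<omega> in M. cell_max f z (\<mm> \<omega>) B \<le> ereal v')\<bar>
    \<le> measure lborel B * \<bar>tail v - tail v'\<bar>" if v: "v \<le> v'" for v v'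
  proof -
    have split: "exceedance {v<..} B = exceedance {v'<..} B \<union> exceedance {v<..v'} B"
      using v by (fastforce simp: exceedance_def)
    have "M.prob (exceedance {v<..} B) \<le> M.prob (exceedance {v'<..} B) + M.prob (exceedance {v<..v'} B)"
      unfolding split using B(1) by (intro measure_Un_le exceedance_sets) auto
    moreover have "M.prob (exceedance {v'<..} B) \<le> M.prob (exceedance {v<..} B)"
      unfolding split using B(1) by (intro M.finite_measure_mono sets.Un exceedance_sets) auto
    moreover have "M.prob (exceedance {v<..v'} B) \<le> measure lborel B * (tail v - tail v')"
      using prob_exceedance_le[OF _ B, of "{v<..v'}"] by (simp only: tail_Ioc[OF v]) auto
    moreover have "tail v - tail v' \<le> \<bar>tail v - tail v'\<bar>" by simp
    then have "measure lborel B * (tail v - tail v') \<le> measure lborel B * \<bar>tail v - tail v'\<bar>"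
      by (intro mult_left_mono) auto
    ultimately show ?thesis by (simp add: prob_cell_max_le[OF B(1)])
  qed
  show ?thesis
  proof (cases "v \<le> v'")
    case False
    then show ?thesis using le[of v' v] by (simp add: abs_minus_commute)
  qed (rule le)
qed

lemma prob_cell_max_translate:
  assumes "B \<in> sets borel" "(+) x ` B \<in> sets borel"
  shows "\<P>(\<omega> in M. cell_max f z (\<mm> \<omega>) ((+) x ` B) \<le> ereal v) = \<P>(\<omega> in M. cell_max f z (\<mm> \<omega>) B \<le> ereal v)"
  using assms by (simp add: prob_cell_max_le exceedance_translate)

end

text \<open>Pairwise independence of the groups would not give a product formula; what is used is
  independence of one group from the union of others. The induction therefore also carries that the
  partial intersection is generated by the union of the groups treated so far.\<close>

lemma prod_eq_of_indep_union:
  assumes "prob_space U" and fin: "finite J" and nonempty: "J \<noteq> {}"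
    and E: "\<And>j. j \<in> J \<Longrightarrow> E j \<in> generated_events M Y (I j)"
    and sp: "\<And>j. j \<in> J \<Longrightarrow> E j \<subseteq> space M"
    and indep: "\<And>J' k. J' \<subseteq> J \<Longrightarrow> J' \<noteq> {} \<Longrightarrow> k \<in> J - J' \<Longrightarrow>
      prob_space.indep_set U (generated_events M Y (\<Union>j\<in>J'. I j)) (generated_events M Y (I k))"
  shows "measure U (\<Inter>j\<in>J. E j) = (\<Prod>j\<in>J. measure U (E j))"
proof -
  interpret U: prob_space U by fact
  have mono: "generated_events M Y A \<subseteq> generated_events M Y B" if "A \<subseteq> B" for A B
    unfolding generated_events_def using that by (intro sigma_sets_mono') blast
  have "measure U (\<Inter>j\<in>J'. E j) = (\<Prod>j\<in>J'. measure U (E j)) \<and>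
      (\<Inter>j\<in>J'. E j) \<in> generated_events M Y (\<Union>j\<in>J'. I j)"
    if "finite J'" "J' \<noteq> {}" "J' \<subseteq> J" for J'
    using that
  proof (induction rule: finite_ne_induct)
    case (singleton k)
    then show ?case using E by simp
  next
    case (insert k J')
    let ?G = "generated_events M Y (\<Union>j\<in>insert k J'. I j)"
    interpret G: sigma_algebra "space M" ?G
      unfolding generated_events_def by (rule sigma_algebra_sigma_sets) auto
    have IH: "measure U (\<Inter>j\<in>J'. E j) = (\<Prod>j\<in>J'. measure U (E j))"
      "(\<Inter>j\<in>J'. E j) \<in> generated_events M Y (\<Union>j\<in>J'. I j)"
      using insert by auto
    have k: "k \<in> J - J'" using insert by auto
    have "U.prob ((\<Inter>j\<in>J'. E j) \<inter> E k) = U.prob (\<Inter>j\<in>J'. E j) * U.prob (E k)"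
      using insert k E by (intro U.indep_setD[OF indep[OF _ _ k] IH(2)]) auto
    then have "U.prob (\<Inter>j\<in>insert k J'. E j) = (\<Prod>j\<in>insert k J'. U.prob (E j))"
      using insert(1,3) IH(1) by (simp add: Int_commute mult.commute)
    moreover have "(\<Inter>j\<in>J'. E j) \<in> ?G" "E k \<in> ?G"
      using IH(2) mono[of "\<Union>j\<in>J'. I j" "\<Union>j\<in>insert k J'. I j"] E[of k] k
        mono[of "I k" "\<Union>j\<in>insert k J'. I j"] by auto
    then have "E k \<inter> (\<Inter>j\<in>J'. E j) \<in> ?G" by (intro G.Int)
    then have "(\<Inter>j\<in>insert k J'. E j) \<in> ?G" by (simp only: INT_insert)
    ultimately show ?case by blast
  qed
  then show ?thesis using fin nonempty by blast
qed

section \<open>Comparison of the window law with a power of the law of a smaller window\<close>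

locale gridded_model = typical_cell_model M \<mm> z N X f
  for M :: "'w measure" and \<mm> :: "'w \<Rightarrow> (real ^ 'n) set set" and z N
    and X :: "'v \<Rightarrow> (real ^ 'n) set" and f +
  fixes a :: "real ^ 'n" and s :: real
  assumes unit_cube: "cbox 0 1 \<subseteq> cube a s"
begin

lemma side_pos: "0 < s"
proof -
  have "0 \<in> cube a s" "1 \<in> cube a s"
    using unit_cube by (auto simp: mem_box_cart)
  then have "a $ r \<le> 0" "1 \<le> a $ r + s" for r
    by (auto simp: cube_def mem_box_cart)
  from this[of undefined] show ?thesis by linarith
qed

abbreviation block_max_le :: "real \<Rightarrow> nat \<Rightarrow> nat \<Rightarrow> real \<Rightarrow> real \<Rightarrow> ('n \<Rightarrow> nat) \<Rightarrow> 'w set" where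
  "block_max_le \<rho> n m \<epsilon> v j \<equiv> {\<omega> \<in> space M. \<forall>i\<in>block_cells a s n m \<epsilon> j.
     subcube_max (cbox 0 1) a s n f z (\<mm> \<omega>) \<rho> i \<le> ereal v}"

lemma block_max_le_eq:
  "block_max_le \<rho> n m \<epsilon> v j = {\<omega> \<in> space M. cell_max f z (\<mm> \<omega>)
    (\<Union>i\<in>block_cells a s n m \<epsilon> j. dilate \<rho> (subcube a s n i) \<inter> dilate \<rho> (cbox 0 1)) \<le> ereal v}"
  by (auto simp: subcube_max_def cell_max_def cells_in_def SUP_le_iff)

text \<open>Two errors arise: exceedances in the gap, and the change to conditional probability
  given \<open>A\<close>. Each is paid once for the whole window and once for each of the
  \<open>m ^ d\<close> blocks, which explains the factor \<open>m ^ d + 1\<close>.\<close>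

lemma prob_block_approx:
  fixes n m :: nat and \<rho> \<epsilon> v :: real and R :: int
  assumes \<rho>: "0 < \<rho>" and m: "0 < m" and n: "0 < n"
    and \<epsilon>: "0 < \<epsilon>" "2 * \<epsilon> * real m < 1"
    and fine: "s / real n \<le> \<epsilon>" "s * (real_of_int R + 1) < 2 * \<epsilon> * real n"
    and A: "A \<in> sets M" "0 < M.prob A"
    and indep: "\<And>I J. I \<subseteq> grid n \<Longrightarrow> J \<subseteq> grid n \<Longrightarrow> I \<noteq> {} \<Longrightarrow> J \<noteq> {} \<Longrightarrow>
      R < index_set_dist I J \<Longrightarrow> prob_space.indep_set (uniform_measure M A)
          (generated_events M (\<lambda>i \<omega>. subcube_max (cbox 0 1) a s n f z (\<mm> \<omega>) \<rho> i) I)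
          (generated_events M (\<lambda>i \<omega>. subcube_max (cbox 0 1) a s n f z (\<mm> \<omega>) \<rho> i) J)"
  shows "\<bar>\<P>(\<omega> in M. cell_max f z (\<mm> \<omega>) (dilate \<rho> (cbox 0 1)) \<le> ereal v) -
      \<P>(\<omega> in M. cell_max f z (\<mm> \<omega>) (dilate (\<rho> / real (m ^ CARD('n))) (cbox 0 1)) \<le> ereal v) ^ (m ^ CARD('n))\<bar>
    \<le> (real (m ^ CARD('n)) + 1) *
      (\<rho> * (1 - (1 - 2 * \<epsilon> * real m) ^ CARD('n)) * tail v + (1 - M.prob A))"
proof -
  let ?W = "cbox 0 (1 :: real ^ 'n)"
  let ?G = "grid m :: ('n \<Rightarrow> nat) set" and ?K = "m ^ CARD('n)"
  let ?P = "\<lambda>B. {\<omega> \<in> space M. cell_max f z (\<mm> \<omega>) B \<le> ereal v}"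
  let ?I = "block_cells a s n m \<epsilon>"
  let ?E = "block_max_le \<rho> n m \<epsilon> v"
  let ?U = "\<lambda>j. \<Union>i\<in>?I j. dilate \<rho> (subcube a s n i) \<inter> dilate \<rho> ?W"
  let ?D = "exceedance {v<..} (dilate \<rho> (block_gap m \<epsilon>))"
  define e where "e = \<rho> * (1 - (1 - 2 * \<epsilon> * real m) ^ CARD('n)) * tail v"
  have I_fin: "finite (?I j)" and I_grid: "?I j \<subseteq> grid n" for j
    by (auto simp: block_cells_def)
  have U_borel: "?U j \<in> sets borel" for j
    using \<rho> by (intro sets.finite_UN I_fin sets.Int borel_dilate borel_subcube) auto
  have W_borel: "dilate \<rho> ?W \<in> sets borel" using \<rho> by (intro borel_dilate) auto
  have dil_mem: "x \<in> dilate \<rho> S \<longleftrightarrow> (1 / \<rho> powr (1 / real CARD('n))) *\<^sub>R x \<in> S" for x and S :: "(real ^ 'n) set"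
    by (simp add: dilate_eq_vimage[OF \<rho>])
  have E_eq: "?E j = ?P (?U j)" for j by (rule block_max_le_eq)
  have E_sets: "?E j \<in> M.events" for j unfolding E_eq by (rule events_cell_max_le[OF U_borel])
  have gap_pos: "0 < 1 - (1 - 2 * \<epsilon> * real m) ^ CARD('n)"
    using \<epsilon> m by (simp add: power_less_one_iff)
  have D_borel: "dilate \<rho> (block_gap m \<epsilon>) \<in> sets borel"
    by (intro borel_dilate \<rho> borel_block_gap)
  have D_sets: "?D \<in> M.events" by (intro exceedance_sets D_borel) auto
  have D_le: "M.prob ?D \<le> e"
  proof -
    have em: "emeasure lborel (dilate \<rho> (block_gap m \<epsilon> :: (real ^ 'n) set)) =
        ennreal (\<rho> * (1 - (1 - 2 * \<epsilon> * real m) ^ CARD('n)))"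
      using \<rho> gap_pos
      by (simp add: emeasure_dilate[OF \<rho> borel_block_gap] emeasure_block_gap[OF m \<epsilon>] ennreal_mult)
    have "M.prob ?D \<le> measure lborel (dilate \<rho> (block_gap m \<epsilon> :: (real ^ 'n) set)) * \<P>(\<omega> in N. f (X \<omega>) \<in> {v<..})"
      by (intro prob_exceedance_le D_borel) (use \<rho> gap_pos in \<open>auto simp: em\<close>)
    then show ?thesis using \<rho> gap_pos by (simp add: e_def measure_def em tail_def)
  qed
  have block_cover: "dilate \<rho> (block m \<epsilon> j) \<subseteq> ?U j" if "j \<in> ?G" for j
  proof
    fix x assume "x \<in> dilate \<rho> (block m \<epsilon> j)"
    then have "(1 / \<rho> powr (1 / real CARD('n))) *\<^sub>R x \<in> block m \<epsilon> j" by (simp only: dil_mem)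
    then show "x \<in> ?U j"
      using block_subset_subcubes[OF unit_cube side_pos n that less_imp_le[OF \<epsilon>(1)]]
        block_subset_unit_cube[OF that less_imp_le[OF \<epsilon>(1)]]
      unfolding UN_iff Int_iff dil_mem by blast
  qed
  have U_block: "?U j \<subseteq> dilate \<rho> (block m 0 j)" for j
  proof
    fix x assume "x \<in> ?U j"
    then show "x \<in> dilate \<rho> (block m 0 j)"
      using subcube_subset_block[OF _ side_pos fine(1)] unfolding UN_iff Int_iff dil_mem by blast
  qed
  have W_cover: "dilate \<rho> ?W \<subseteq> (\<Union>j\<in>?G. ?U j) \<union> dilate \<rho> (block_gap m \<epsilon>)"
  proof
    fix x assume x: "x \<in> dilate \<rho> ?W"
    show "x \<in> (\<Union>j\<in>?G. ?U j) \<union> dilate \<rho> (block_gap m \<epsilon>)"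
    proof (cases "\<exists>j\<in>?G. x \<in> dilate \<rho> (block m \<epsilon> j)")
      case True
      then show ?thesis using block_cover by blast
    next
      case False
      then show ?thesis using x by (auto simp: dil_mem block_gap_def)
    qed
  qed
  \<comment> \<open>A point of a full block outside its own shrunken block cannot lie in another
    shrunken block: full blocks share at most faces, and the margin keeps the others away from
    these. So it lies in the gap.\<close>
  have block_cover': "dilate \<rho> (block m 0 j) \<subseteq> ?U j \<union> dilate \<rho> (block_gap m \<epsilon>)" if j: "j \<in> ?G" for j
  proof
    fix x assume x: "x \<in> dilate \<rho> (block m 0 j)"
    let ?y = "(1 / \<rho> powr (1 / real CARD('n))) *\<^sub>R x"
    have y: "?y \<in> block m 0 j" using x by (simp add: dil_mem)
    show "x \<in> ?U j \<union> dilate \<rho> (block_gap m \<epsilon>)"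
    proof (cases "?y \<in> block m \<epsilon> j")
      case True
      then have "x \<in> dilate \<rho> (block m \<epsilon> j)" by (simp add: dil_mem)
      then show ?thesis using block_cover[OF j] by blast
    next
      case False
      have "?y \<notin> block m \<epsilon> k" if "k \<in> ?G" for k
      proof
        assume k: "?y \<in> block m \<epsilon> k"
        then have "j \<noteq> k" using False by auto
        then obtain r where "j r \<noteq> k r" by auto
        then consider "j r + 1 \<le> k r" | "k r + 1 \<le> j r" by linarith
        then show False
        proof cases
          case 1
          then have "real (j r + 1) / real m \<le> real (k r) / real m" by (intro divide_right_mono) auto
          moreover have "?y $ r \<le> real (j r + 1) / real m - 0" using y unfolding mem_block by blast
          moreover have "real (k r) / real m + \<epsilon> \<le> ?y $ r" using k unfolding mem_block by blast
          ultimately show False using \<epsilon>(1) by linarith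
        next
          case 2
          then have "real (k r + 1) / real m \<le> real (j r) / real m" by (intro divide_right_mono) auto
          moreover have "real (j r) / real m + 0 \<le> ?y $ r" using y unfolding mem_block by blast
          moreover have "?y $ r \<le> real (k r + 1) / real m - \<epsilon>" using k unfolding mem_block by blast
          ultimately show False using \<epsilon>(1) by linarith
        qed
      qed
      moreover have "?y \<in> ?W" using block_subset_unit_cube[OF j, of 0] y by auto
      ultimately show ?thesis by (auto simp: dil_mem block_gap_def)
    qed
  qed
  have P_mono: "?P B' \<subseteq> ?P B" if "B \<subseteq> B'" for B B'
    using that by (auto simp: cell_max_le_eq exceedance_def)
  have P_cover: "?P B' \<subseteq> ?P B \<union> ?D" if "B \<subseteq> B' \<union> dilate \<rho> (block_gap m \<epsilon>)" for B B'
    using that unfolding cell_max_le_eq by (auto simp: exceedance_def)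
  \<comment> \<open>Serves twice, with \<open>S\<close> the joint event compared to the whole
    window, and with \<open>S\<close> the event of one block compared to its full block.\<close>
  have close: "M.prob (?P B) \<le> M.prob S" "M.prob S \<le> M.prob (?P B) + e"
    if S: "?P B \<subseteq> S" "S \<subseteq> ?P B \<union> ?D" "S \<in> M.events" "B \<in> sets borel" for B S
  proof -
    show "M.prob (?P B) \<le> M.prob S" by (rule M.finite_measure_mono[OF S(1,3)])
    have "M.prob S \<le> M.prob (?P B \<union> ?D)"
      using S D_sets by (intro M.finite_measure_mono sets.Un events_cell_max_le) auto
    also have "\<dots> \<le> M.prob (?P B) + M.prob ?D"
      using S D_sets by (intro measure_Un_le events_cell_max_le) auto
    finally show "M.prob S \<le> M.prob (?P B) + e" using D_le by simp
  qed
  have G_ne: "?G \<noteq> {}" using m by (auto simp: grid_def)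
  have all_sets: "(\<Inter>j\<in>?G. ?E j) \<in> M.events"
    using E_sets G_ne by (intro sets.finite_INT) auto
  have all_close: "\<bar>M.prob (?P (dilate \<rho> ?W)) - M.prob (\<Inter>j\<in>?G. ?E j)\<bar> \<le> e"
  proof -
    have lower: "?P (dilate \<rho> ?W) \<subseteq> (\<Inter>j\<in>?G. ?E j)"
      unfolding E_eq by (intro INT_greatest P_mono) auto
    have upper: "(\<Inter>j\<in>?G. ?E j) \<subseteq> ?P (dilate \<rho> ?W) \<union> ?D"
    proof -
      have "(\<Inter>j\<in>?G. ?P (?U j)) = ?P (\<Union>j\<in>?G. ?U j)"
        using G_ne by (auto simp: cell_max_def cells_in_def SUP_le_iff)
      then show ?thesis unfolding E_eq using P_cover[OF W_cover] by simp
    qed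
    show ?thesis using close[OF lower upper all_sets W_borel] by linarith
  qed
  define p where "p = M.prob (?P (dilate (\<rho> / real ?K) ?W))"
  have block_close: "\<bar>M.prob (?E j) - p\<bar> \<le> e" if j: "j \<in> ?G" for j
  proof -
    have borel: "dilate \<rho> (block m 0 j) \<in> sets borel"
      using \<rho> by (intro borel_dilate) (auto simp: block_def)
    have "p = M.prob (?P (dilate \<rho> (block m 0 j)))"
      using borel \<rho> m unfolding p_def dilate_block_0[OF \<rho> m]
      by (intro prob_cell_max_translate[symmetric] borel_dilate) auto
    moreover have lower: "?P (dilate \<rho> (block m 0 j)) \<subseteq> ?E j"
      unfolding E_eq by (intro P_mono U_block)
    have upper: "?E j \<subseteq> ?P (dilate \<rho> (block m 0 j)) \<union> ?D"
      unfolding E_eq by (rule P_cover[OF block_cover'[OF j]])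
    ultimately show ?thesis using close[OF lower upper E_sets borel] by linarith
  qed
  interpret U: prob_space "uniform_measure M A"
    using A(2) by (intro prob_space_uniform_measure) (auto simp: M.emeasure_eq_measure)
  \<comment> \<open>Required because the independence hypothesis speaks only of nonempty index
    sets.\<close>
  have I_ne: "?I j \<noteq> {}" if "j \<in> ?G" for j
  proof -
    have "0 < 1 / real m - 2 * \<epsilon>" using m \<epsilon>(2) by (simp add: field_simps)
    then have "(\<chi> r. real (j r) / real m + \<epsilon>) \<in> block m \<epsilon> j"
      by (simp add: mem_block add_divide_distrib)
    then show ?thesis
      using block_subset_subcubes[OF unit_cube side_pos n that, of \<epsilon>] \<epsilon> by fastforce
  qed
  have prod: "U.prob (\<Inter>j\<in>?G. ?E j) = (\<Prod>j\<in>?G. U.prob (?E j))"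
  proof (rule prod_eq_of_indep_union[OF U.prob_space_axioms finite_grid G_ne,
      where I = ?I and Y = "\<lambda>i \<omega>. subcube_max ?W a s n f z (\<mm> \<omega>) \<rho> i" and M = M])
    show "?E j \<in> generated_events M (\<lambda>i \<omega>. subcube_max ?W a s n f z (\<mm> \<omega>) \<rho> i) (?I j)" if "j \<in> ?G" for j
      by (rule le_of_generated_events[OF I_fin I_ne[OF that]])
  next
    fix J' and k :: "'n \<Rightarrow> nat" assume J': "J' \<subseteq> ?G" "J' \<noteq> {}" "k \<in> ?G - J'"
    have "finite J'" using finite_subset[OF J'(1)] by simp
    have ne: "(\<Union>j\<in>J'. ?I j) \<noteq> {}" using J'(1,2) I_ne by blast
    have "R < index_set_dist (\<Union>j\<in>J'. ?I j) (?I k)"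
    proof (rule index_set_dist_gt)
      show "R < index_dist i l" if "i \<in> (\<Union>j\<in>J'. ?I j)" "l \<in> ?I k" for i l
        using that J' index_dist_block_cells[OF _ _ _ m side_pos n fine(2)] by blast
    qed (use \<open>finite J'\<close> I_fin I_ne J'(3) ne in auto)
    then show "U.indep_set (generated_events M (\<lambda>i \<omega>. subcube_max ?W a s n f z (\<mm> \<omega>) \<rho> i) (\<Union>j\<in>J'. ?I j))
        (generated_events M (\<lambda>i \<omega>. subcube_max ?W a s n f z (\<mm> \<omega>) \<rho> i) (?I k))"
      using J'(3) I_grid I_ne ne by (intro indep) auto
  qed auto
  have U_close: "\<bar>U.prob S - M.prob S\<bar> \<le> 1 - M.prob A" if "S \<in> M.events" for S
    by (rule M.abs_prob_uniform_measure_diff_le[OF A that])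
  have card: "card ?G = ?K" by (rule card_grid)
  \<comment> \<open>For factors in \<open>[0, 1]\<close> the difference of two products is at most
    the sum of the differences of the factors.\<close>
  have "\<bar>(\<Prod>j\<in>?G. U.prob (?E j)) - (\<Prod>j\<in>?G. p)\<bar> \<le> (\<Sum>j\<in>?G. \<bar>U.prob (?E j) - p\<bar>)"
    using norm_prod_diff[of ?G "\<lambda>j. U.prob (?E j)" "\<lambda>_. p"] by (simp add: p_def)
  also have "\<dots> \<le> (\<Sum>j\<in>?G. (1 - M.prob A) + e)"
  proof (rule sum_mono)
    fix j assume "j \<in> ?G"
    then show "\<bar>U.prob (?E j) - p\<bar> \<le> (1 - M.prob A) + e"
      using U_close[OF E_sets, of j] block_close[of j] by linarith
  qed
  finally have "\<bar>U.prob (\<Inter>j\<in>?G. ?E j) - p ^ ?K\<bar> \<le> real ?K * ((1 - M.prob A) + e)"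
    by (simp add: card prod)
  then have "\<bar>M.prob (?P (dilate \<rho> ?W)) - p ^ ?K\<bar> \<le> e + (1 - M.prob A) + real ?K * ((1 - M.prob A) + e)"
    using all_close U_close[OF all_sets] by linarith
  also have "\<dots> = (real ?K + 1) * (e + (1 - M.prob A))" by (simp add: algebra_simps)
  finally show ?thesis by (simp add: p_def e_def)
qed

end

section \<open>Passage to the limit\<close>

lemma filterlim_of_power_at_top:
  fixes n :: "real \<Rightarrow> nat"
  assumes "filterlim (\<lambda>\<rho>. n \<rho> ^ d) at_top at_top"
  shows "filterlim n at_top at_top"
  unfolding filterlim_at_top
proof
  fix Z
  have "\<forall>\<^sub>F \<rho> in at_top. Suc Z ^ d \<le> n \<rho> ^ d"
    using assms unfolding filterlim_at_top by blast
  \<comment> \<open>This excludes \<open>d = 0\<close>, for which the power would be constantly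
    1.\<close>
  moreover have "\<forall>\<^sub>F \<rho> in at_top. 2 \<le> n \<rho> ^ d"
    using assms unfolding filterlim_at_top by blast
  ultimately show "\<forall>\<^sub>F \<rho> in at_top. Z \<le> n \<rho>"
  proof eventually_elim
    case (elim \<rho>)
    then have "0 < d" by (cases d) auto
    show ?case
    proof (rule ccontr)
      assume "\<not> Z \<le> n \<rho>"
      then have "n \<rho> ^ d < Suc Z ^ d" using \<open>0 < d\<close> by (intro power_strict_mono) auto
      with elim show False by simp
    qed
  qed
qed

context gridded_model
begin

abbreviation window_cdf :: "real \<Rightarrow> real \<Rightarrow> real" where
  "window_cdf \<rho> v \<equiv> \<P>(\<omega> in M. cell_max f z (\<mm> \<omega>) (dilate \<rho> (cbox 0 1)) \<le> ereal v)"

lemma emeasure_window: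
  assumes "0 < \<rho>"
  shows "emeasure lborel (dilate \<rho> (cbox 0 (1 :: real ^ 'n))) = ennreal \<rho>"
proof -
  have "emeasure lborel (cbox 0 (1 :: real ^ 'n)) = ennreal (measure lborel (cbox 0 (1 :: real ^ 'n)))"
    using emeasure_lborel_cbox_finite[of 0 "1 :: real ^ 'n"] by (intro emeasure_eq_ennreal_measure) auto
  also have "measure lborel (cbox 0 (1 :: real ^ 'n)) = 1"
    by (subst content_cbox_cart) (auto simp: interval_ne_empty_cart)
  finally show ?thesis using assms by (simp add: emeasure_dilate)
qed

lemma window_cdf_diff_le:
  assumes "0 < \<rho>"
  shows "\<bar>window_cdf \<rho> v - window_cdf \<rho> v'\<bar> \<le> \<bar>\<rho> * tail v - \<rho> * tail v'\<bar>"
proof -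
  have "\<bar>window_cdf \<rho> v - window_cdf \<rho> v'\<bar> \<le> \<rho> * \<bar>tail v - tail v'\<bar>"
    using prob_cell_max_diff_le[of "dilate \<rho> (cbox 0 1)" v v'] assms
    by (simp add: emeasure_window borel_dilate measure_def)
  then show ?thesis using assms by (simp add: abs_mult flip: right_diff_distrib)
qed

lemma window_cdf_ge:
  assumes "0 < \<rho>"
  shows "1 - window_cdf \<rho> v \<le> \<rho> * tail v"
proof -
  have B: "dilate \<rho> (cbox 0 (1 :: real ^ 'n)) \<in> sets borel" using assms by (simp add: borel_dilate)
  have "M.prob (exceedance {v<..} (dilate \<rho> (cbox 0 1))) \<le> \<rho> * tail v"
    using prob_exceedance_le[OF _ B, of "{v<..}"] assms
    by (simp add: emeasure_window measure_def tail_def)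
  then show ?thesis by (simp add: prob_cell_max_le[OF B])
qed

text \<open>The margin \<open>\<epsilon>\<close> is fixed first, so that the limiting gap error
  takes at most half of \<open>e\<close>. Then \<open>\<rho>\<close> grows until the sub-cubes are
  fine enough and \<open>A\<close> is likely enough. The other half of \<open>e\<close> pays for
  replacing the threshold \<open>v \<rho> \<tau>\<close> in the small window by the one belonging to
  \<open>\<rho>/K\<close> and \<open>\<tau>/K\<close>.\<close>

lemma window_cdf_scaling:
  assumes grid: "\<forall>\<rho>>0. n \<rho> > 0" "filterlim (\<lambda>\<rho>. n \<rho> ^ CARD('n)) at_top at_top"
    and mixing: "mixing_condition M \<mm> z f (cbox 0 1) a s n"
    and threshold: "\<And>\<tau>. 0 \<le> \<tau> \<Longrightarrow> ((\<lambda>\<rho>. \<rho> * tail (v \<rho> \<tau>)) \<longlongrightarrow> \<tau>) at_top"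
    and m: "1 \<le> m" and \<tau>: "0 \<le> \<tau>"
  shows "((\<lambda>\<rho>. window_cdf \<rho> (v \<rho> \<tau>) -
      window_cdf (\<rho> / real (m ^ CARD('n))) (v (\<rho> / real (m ^ CARD('n))) (\<tau> / real (m ^ CARD('n))))
        ^ (m ^ CARD('n))) \<longlongrightarrow> 0) at_top"
proof (rule tendstoI)
  fix e :: real assume e: "0 < e"
  let ?K = "m ^ CARD('n)"
  let ?gap = "\<lambda>\<epsilon>. 1 - (1 - 2 * \<epsilon> * real m) ^ CARD('n)"
  have K: "0 < real ?K" using m by simp
  obtain R A where A: "\<forall>\<rho>>0. A \<rho> \<in> sets M" "((\<lambda>\<rho>. M.prob (A \<rho>)) \<longlongrightarrow> 1) at_top"
    and all_indep: "\<forall>\<rho>>0. \<forall>I J. I \<subseteq> grid (n \<rho>) \<and> J \<subseteq> grid (n \<rho>) \<and> I \<noteq> {} \<and> J \<noteq> {} \<and>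
        R < index_set_dist I J \<longrightarrow> prob_space.indep_set (uniform_measure M (A \<rho>))
          (generated_events M (\<lambda>i \<omega>. subcube_max (cbox 0 1) a s (n \<rho>) f z (\<mm> \<omega>) \<rho> i) I)
          (generated_events M (\<lambda>i \<omega>. subcube_max (cbox 0 1) a s (n \<rho>) f z (\<mm> \<omega>) \<rho> i) J)"
    using mixing unfolding mixing_condition_def by (elim exE conjE) (rule that)
  note indep = all_indep[rule_format, OF _ conjI[OF _ conjI[OF _ conjI[OF _ conjI]]]]
  \<comment> \<open>The gap volume vanishes with \<open>\<epsilon>\<close>, and the factor
    \<open>\<tau>\<close> anticipates the limit of \<open>\<rho>\<close> times the tail.\<close>
  have "((\<lambda>\<epsilon>. (real ?K + 1) * (?gap \<epsilon> * \<tau>)) \<longlongrightarrow> (real ?K + 1) * (?gap 0 * \<tau>)) (at_right 0)"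
    by (intro tendsto_intros)
  then have "\<forall>\<^sub>F \<epsilon> in at_right 0. (real ?K + 1) * (?gap \<epsilon> * \<tau>) < e / 2"
    by (rule order_tendstoD(2)) (use e in simp)
  moreover have "\<forall>\<^sub>F \<epsilon> in at_right 0. 2 * \<epsilon> * real m < 1"
  proof -
    have "((\<lambda>\<epsilon>. 2 * \<epsilon> * real m) \<longlongrightarrow> 2 * 0 * real m) (at_right 0)" by (intro tendsto_intros)
    then show ?thesis by (rule order_tendstoD(2)) simp
  qed
  moreover have "\<forall>\<^sub>F \<epsilon> :: real in at_right 0. 0 < \<epsilon>" by (rule eventually_at_right_less)
  ultimately have "\<forall>\<^sub>F \<epsilon> in at_right 0. 0 < \<epsilon> \<and> 2 * \<epsilon> * real m < 1 \<and> (real ?K + 1) * (?gap \<epsilon> * \<tau>) < e / 2"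
    by eventually_elim auto
  then obtain \<epsilon> where \<epsilon>: "0 < \<epsilon>" "2 * \<epsilon> * real m < 1" "(real ?K + 1) * (?gap \<epsilon> * \<tau>) < e / 2"
    using eventually_happens[of _ "at_right (0::real)"] by auto
  let ?h = "\<lambda>\<rho>. (real ?K + 1) * (\<rho> * ?gap \<epsilon> * tail (v \<rho> \<tau>) + (1 - M.prob (A \<rho>)))"
  \<comment> \<open>\<open>K\<close> times the difference of the mean numbers of exceedances of the
    two thresholds in the small window; each mean number tends to \<open>\<tau> / K\<close>, so this
    tends to 0.\<close>
  let ?k = "\<lambda>\<rho>. \<rho> * tail (v \<rho> \<tau>) - real ?K * (\<rho> / real ?K * tail (v (\<rho> / real ?K) (\<tau> / real ?K)))"
  have "((\<lambda>\<rho>. (real ?K + 1) * (?gap \<epsilon> * (\<rho> * tail (v \<rho> \<tau>)) + (1 - M.prob (A \<rho>))))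
      \<longlongrightarrow> (real ?K + 1) * (?gap \<epsilon> * \<tau> + (1 - 1))) at_top"
    by (intro tendsto_intros threshold \<tau> A(2))
  then have "(?h \<longlongrightarrow> (real ?K + 1) * (?gap \<epsilon> * \<tau>)) at_top" by (simp add: mult_ac)
  then have h: "\<forall>\<^sub>F \<rho> in at_top. ?h \<rho> < e / 2" using \<epsilon>(3) by (rule order_tendstoD(2))
  have "filterlim (\<lambda>\<rho>. \<rho> / real ?K) at_top at_top"
    using filtermap_divide_pos_at_top[OF K] by (simp add: filterlim_def)
  from filterlim_compose[OF threshold this, of "\<tau> / real ?K"]
  have "((\<lambda>\<rho>. \<rho> / real ?K * tail (v (\<rho> / real ?K) (\<tau> / real ?K))) \<longlongrightarrow> \<tau> / real ?K) at_top"
    using \<tau> by simp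
  then have "(?k \<longlongrightarrow> \<tau> - real ?K * (\<tau> / real ?K)) at_top"
    by (intro tendsto_intros threshold \<tau>)
  then have "((\<lambda>\<rho>. \<bar>?k \<rho>\<bar>) \<longlongrightarrow> 0) at_top" using K by (intro tendsto_rabs_zero) simp
  then have k: "\<forall>\<^sub>F \<rho> in at_top. \<bar>?k \<rho>\<bar> < e / 2" by (rule order_tendstoD(2)) (use e in simp)
  have n_lim: "filterlim (\<lambda>\<rho>. real (n \<rho>)) at_top at_top"
    by (rule filterlim_compose[OF filterlim_real_sequentially filterlim_of_power_at_top[OF grid(2)]])
  have n1: "\<forall>\<^sub>F \<rho> in at_top. s / \<epsilon> \<le> real (n \<rho>)"
    using n_lim unfolding filterlim_at_top by blast
  have n2: "\<forall>\<^sub>F \<rho> in at_top. s * (real_of_int R + 1) / (2 * \<epsilon>) < real (n \<rho>)"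
    using n_lim unfolding filterlim_at_top_dense by blast
  have A_pos: "\<forall>\<^sub>F \<rho> in at_top. 0 < M.prob (A \<rho>)"
    using A(2) by (rule order_tendstoD(1)) simp
  show "\<forall>\<^sub>F \<rho> in at_top. dist (window_cdf \<rho> (v \<rho> \<tau>) -
      window_cdf (\<rho> / real ?K) (v (\<rho> / real ?K) (\<tau> / real ?K)) ^ ?K) 0 < e"
    using h k n1 n2 A_pos eventually_gt_at_top[of 0]
  proof eventually_elim
    case (elim \<rho>)
    have n_pos: "0 < n \<rho>" using grid(1) elim by blast
    let ?p = "window_cdf (\<rho> / real ?K) (v \<rho> \<tau>)"
    let ?q = "window_cdf (\<rho> / real ?K) (v (\<rho> / real ?K) (\<tau> / real ?K))"
    have fine: "s / real (n \<rho>) \<le> \<epsilon>" "s * (real_of_int R + 1) < 2 * \<epsilon> * real (n \<rho>)"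
      using elim(3,4) n_pos \<epsilon>(1) by (simp_all add: field_simps)
    have "\<bar>window_cdf \<rho> (v \<rho> \<tau>) - ?p ^ ?K\<bar> \<le> ?h \<rho>"
      by (rule prob_block_approx[OF elim(6) _ n_pos \<epsilon>(1,2) fine _ elim(5) indep[OF elim(6)]])
        (use A(1) elim(6) m in auto)
    \<comment> \<open>On \<open>[0, 1]\<close> the \<open>K\<close>-th power is Lipschitz with
      constant \<open>K\<close>.\<close>
    moreover have "\<bar>?p ^ ?K - ?q ^ ?K\<bar> \<le> real ?K * \<bar>?p - ?q\<bar>"
      using norm_power_diff[of ?p ?q ?K] by simp
    moreover have "real ?K * \<bar>?p - ?q\<bar> \<le> \<bar>?k \<rho>\<bar>"
    proof -
      have "\<bar>?p - ?q\<bar> \<le> \<bar>\<rho> / real ?K * tail (v \<rho> \<tau>) - \<rho> / real ?K * tail (v (\<rho> / real ?K) (\<tau> / real ?K))\<bar>"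
        using elim(6) K by (intro window_cdf_diff_le divide_pos_pos)
      then have "real ?K * \<bar>?p - ?q\<bar> \<le>
          real ?K * \<bar>\<rho> / real ?K * tail (v \<rho> \<tau>) - \<rho> / real ?K * tail (v (\<rho> / real ?K) (\<tau> / real ?K))\<bar>"
        using K by (intro mult_left_mono) auto
      also have "\<dots> = \<bar>real ?K * (\<rho> / real ?K * tail (v \<rho> \<tau>) - \<rho> / real ?K * tail (v (\<rho> / real ?K) (\<tau> / real ?K)))\<bar>"
        using K by (simp only: abs_mult abs_of_pos)
      also have "\<dots> = \<bar>?k \<rho>\<bar>"
        using K by (simp only: right_diff_distrib) simp
      finally show ?thesis .
    qed
    ultimately show ?case using elim(1,2) unfolding dist_real_def diff_0_right by linarith
  qed
qed

end

theorem proposition3: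
  fixes M :: "'w measure" and \<mm> :: "'w \<Rightarrow> (real ^ 'n) set set"
    and N :: "'v measure" and X :: "'v \<Rightarrow> (real ^ 'n) set"
    and z :: "(real ^ 'n) set \<Rightarrow> real ^ 'n"
    and f :: "(real ^ 'n) set \<Rightarrow> real"
    and W :: "(real ^ 'n) set"
    and a :: "real ^ 'n" and s :: real and n :: "real \<Rightarrow> nat"
    and v :: "real \<Rightarrow> real \<Rightarrow> real"
  assumes W: "W = cbox 0 1"
    and tessellation: "random_tessellation M \<mm>" "stationary M \<mm>"
    and nucleus: "nucleus_map z"
    and intensity: "has_intensity M \<mm> z 1"
    and typical: "typical_cell M \<mm> z N X"
    and f: "translation_invariant f" "f \<in> borel_measurable convex_body_borel"
    and cube: "W \<subseteq> cube a s"
    and grid: "\<forall>\<rho>>0. n \<rho> > 0"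
      "filterlim (\<lambda>\<rho>. n \<rho> ^ CARD('n)) at_top at_top"
    and mixing: "mixing_condition M \<mm> z f W a s n"
    and threshold: "\<forall>\<tau>\<ge>0. ((\<lambda>\<rho>. \<rho> * \<P>(\<omega> in N. f (X \<omega>) > v \<rho> \<tau>)) \<longlongrightarrow> \<tau>) at_top"
  shows "\<exists>\<theta> \<theta>' :: real. 0 \<le> \<theta> \<and> \<theta> \<le> \<theta>' \<and> \<theta>' \<le> 1 \<and>
    (\<forall>\<tau>\<ge>0.
      Limsup at_top (\<lambda>\<rho>. ereal (\<P>(\<omega> in M. cell_max f z (\<mm> \<omega>) (dilate \<rho> W) \<le> ereal (v \<rho> \<tau>))))
        = ereal (exp (- \<theta> * \<tau>)) \<and>
      Liminf at_top (\<lambda>\<rho>. ereal (\<P>(\<omega> in M. cell_max f z (\<mm> \<omega>) (dilate \<rho> W) \<le> ereal (v \<rho> \<tau>))))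
        = ereal (exp (- \<theta>' * \<tau>))) \<and>
    ((\<exists>\<tau>>0. \<exists>L. ((\<lambda>\<rho>. \<P>(\<omega> in M. cell_max f z (\<mm> \<omega>) (dilate \<rho> W) \<le> ereal (v \<rho> \<tau>))) \<longlongrightarrow> L) at_top)
      \<longrightarrow> \<theta> = \<theta>' \<and>
        (\<forall>\<tau>\<ge>0. ((\<lambda>\<rho>. \<P>(\<omega> in M. cell_max f z (\<mm> \<omega>) (dilate \<rho> W) \<le> ereal (v \<rho> \<tau>)))
          \<longlongrightarrow> exp (- \<theta> * \<tau>)) at_top))"

proof -
  interpret gridded_model M \<mm> z N X f a s
    using tessellation nucleus intensity typical f cube unfolding W by unfold_locales auto
  have thr: "((\<lambda>\<rho>. \<rho> * tail (v \<rho> \<tau>)) \<longlongrightarrow> \<tau>) at_top" if "0 \<le> \<tau>" for \<tau>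
    using threshold that by (simp add: tail_def)
  show ?thesis
    unfolding W
  \<comment> \<open>Applied with
    \<open>F \<rho> \<tau> = window_cdf \<rho> (v \<rho> \<tau>)\<close>. The bounds 0 and 1 hold
    for every \<open>\<rho>\<close> because these are probabilities; the other estimates concern
    positive \<open>\<rho>\<close> and enter only eventually.\<close>
  proof (rule extremal_exponents[of "CARD('n)"])
    fix m :: nat and \<tau> :: real assume "1 \<le> m" "0 \<le> \<tau>"
    with thr show "((\<lambda>\<rho>. window_cdf \<rho> (v \<rho> \<tau>) -
      window_cdf (\<rho> / real (m ^ CARD('n))) (v (\<rho> / real (m ^ CARD('n))) (\<tau> / real (m ^ CARD('n))))
        ^ (m ^ CARD('n))) \<longlongrightarrow> 0) at_top"
      by (rule window_cdf_scaling[OF grid mixing[unfolded W]])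
  next
    fix \<tau> \<tau>' :: real assume "0 \<le> \<tau>" "0 \<le> \<tau>'"
    then have "((\<lambda>\<rho>. \<bar>\<rho> * tail (v \<rho> \<tau>) - \<rho> * tail (v \<rho> \<tau>')\<bar>) \<longlongrightarrow> \<bar>\<tau> - \<tau>'\<bar>) at_top"
      by (intro tendsto_intros thr)
    moreover have "\<forall>\<^sub>F \<rho> in at_top. \<bar>window_cdf \<rho> (v \<rho> \<tau>) - window_cdf \<rho> (v \<rho> \<tau>')\<bar>
        \<le> \<bar>\<rho> * tail (v \<rho> \<tau>) - \<rho> * tail (v \<rho> \<tau>')\<bar>"
      using eventually_gt_at_top[of 0] by eventually_elim (rule window_cdf_diff_le)
    ultimately show "\<exists>h. (h \<longlongrightarrow> \<bar>\<tau> - \<tau>'\<bar>) at_top \<and>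
        (\<forall>\<^sub>F \<rho> in at_top. \<bar>window_cdf \<rho> (v \<rho> \<tau>) - window_cdf \<rho> (v \<rho> \<tau>')\<bar> \<le> h \<rho>)"
      by blast
  next
    fix \<tau> :: real assume "0 \<le> \<tau>"
    moreover have "\<forall>\<^sub>F \<rho> in at_top. 1 - window_cdf \<rho> (v \<rho> \<tau>) \<le> \<rho> * tail (v \<rho> \<tau>)"
      using eventually_gt_at_top[of 0] by eventually_elim (rule window_cdf_ge)
    ultimately show "\<exists>h. (h \<longlongrightarrow> \<tau>) at_top \<and> (\<forall>\<^sub>F \<rho> in at_top. 1 - window_cdf \<rho> (v \<rho> \<tau>) \<le> h \<rho>)"
      using thr by blast
  qed auto
qed

end
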